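(* The diversity $(\mathbb{U},\delta_{\mathbb{U}})$ (constructed in the context) is a universal Polish diversity; that is, its induced metric space is separable and complete, and every separable diversity is isomorphic to a subset of $\mathbb{U}$ (equipped with the restriction of $\delta_{\mathbb{U}}$).
   Context: Write $\mathcal{P}_{\mathrm{fin}}(X)$ for the set of finite subsets of $X$. A diversity is a pair $(X,\delta)$ with $X$ a set and $\delta:\mathcal{P}_{\mathrm{fin}}(X)\to\mathbb{R}$ such that for all finite $A,B,C\subseteq X$: (D1) $\delta(A)\ge 0$, and $\delta(A)=0$ if and only if $|A|\le 1$; (D2) if $B\ne\emptyset$ then $\delta(A\cup B)+\delta(B\cup C)\ge\delta(A\cup C)$. The induced metric is $d(a,b)=\delta(\{a,b\})$. A diversity is separable (complete, Polish) if its induced metric space is separable (complete, separable and complete). A subset of $X$ is a diversity under the restriction of $\delta$. An isomorphism from $(X,\delta_X)$ onto $(Y,\delta_Y)$ is a bijection $\phi$ with $\delta_Y(\phi(A))=\delta_X(A)$ for all finite $A\subseteq X$. A Polish diversity is universal if every separable diversity is isomorphic to a subset of it. Admissible functions: $f:\mathcal{P}_{\mathrm{fin}}(X)\to\mathbb{R}$ is admissible on $(X,\delta)$ if for some point $z$ (possibly in $X$) there is a diversity $(X\cup\{z\},\delta')$ with $\delta'(A)=\delta(A)$ and $\delta'(A\cup\{z\})=f(A)$ for all finite $A\subseteq X$. $E(X)$ is the set of admissible functions on $(X,\delta)$. It carries the diversity $\widehat\delta$ with $\widehat\delta(\emptyset)=\widehat\delta(\{f\})=0$ and, for distinct $f_1,\dots,f_k$,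 $k\ge 2$, $$\widehat\delta(\{f_1,\ldots,f_k\})=\max_{1\le j\le k}\ \sup_{A_1,\ldots,A_k}\Big\{f_j\big(\bigcup_{i\ne j}A_i\big)-\sum_{i\ne j}f_i(A_i)\Big\},$$ the $A_i$ ranging over finite subsets of $X$. $(X,\delta)$ embeds in $(E(X),\widehat\delta)$ via $x\mapsto\kappa_x$, $\kappa_x(A)=\delta(A\cup\{x\})$. Finite support: for nonempty $S\subseteq X$ and $f\in E(S)$ ($S$ with the restricted diversity), let $$f_S^X(A)=\inf\Big\{f(B)+\sum_{b\in B}\delta(A_b\cup\{b\}) : B\subseteq S\text{ finite},\ \bigcup_{b\in B}A_b=A\Big\}$$ for finite $A\subseteq X$. A function $g\in E(X)$ is finitely supported if $g=f_S^X$ for some finite nonempty $S\subseteq X$ and $f\in E(S)$. $E(X,\omega)$ is the set of finitely supported elements of $E(X)$, with the diversity $\widehat\delta$; it contains all $\kappa_x$. Construction: given $(X,\delta)$, put $(X_0,\delta_0)=(X,\delta)$ and $X_n=E(X_{n-1},\omega)$, $\delta_n=\widehat{\delta_{n-1}}$ for $n\ge 1$. Identifying $X_{n-1}$ with its image in $X_n$ under $x\mapsto\kappa_x$, let $(X_\omega,\delta_\omega)$ be the union (direct limit) of the $(X_n,\delta_n)$. The completion of a diversity is the completion of its induced metric space, with the diversity function extended by continuity (i.e. so that $(a_1,\dots,a_k)\mapsto\delta(\{a_1,\dots,a_k\})$ is continuous for each $k$). $(\mathbb{U},\delta_{\mathbb{U}})$ is the completion of $(X_\omega,\delta_\omega)$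 when $(X,\delta)$ is the diversity on a single point. *)

theory Defs
  imports "HOL-Analysis.Analysis"
begin

section \<open>Diversities\<close>

text \<open>A diversity function is an HOL function on all sets; only its values on \<open>Fpow X\<close>,
  the finite subsets of the carrier, are meaningful.  A subset of a diversity is therefore a
  diversity under the same function.\<close>

definition diversity :: "'a set \<Rightarrow> ('a set \<Rightarrow> real) \<Rightarrow> bool" where
  "diversity X \<delta> \<longleftrightarrow>
     (\<forall>A\<in>Fpow X. 0 \<le> \<delta> A \<and> (\<delta> A = 0 \<longleftrightarrow> card A \<le> 1)) \<and>
     (\<forall>A\<in>Fpow X. \<forall>B\<in>Fpow X. \<forall>C\<in>Fpow X.
        B \<noteq> {} \<longrightarrow> \<delta> (A \<union> B) + \<delta> (B \<union> C) \<ge> \<delta> (A \<union> C))"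

text \<open>The value 0 off the carrier is irrelevant; it is there because the locale
  \<open>Metric_space\<close> asks for nonnegativity and symmetry on the whole type.\<close>

definition induced_dist :: "'a set \<Rightarrow> ('a set \<Rightarrow> real) \<Rightarrow> 'a \<Rightarrow> 'a \<Rightarrow> real" where
  "induced_dist X \<delta> a b = (if a \<in> X \<and> b \<in> X then \<delta> {a, b} else 0)"

definition separable_diversity :: "'a set \<Rightarrow> ('a set \<Rightarrow> real) \<Rightarrow> bool" where
  "separable_diversity X \<delta> \<longleftrightarrow>
     diversity X \<delta> \<and> separable_space (Metric_space.mtopology X (induced_dist X \<delta>))"

definition complete_diversity :: "'a set \<Rightarrow> ('a set \<Rightarrow> real) \<Rightarrow> bool" where
  "complete_diversity X \<delta> \<longleftrightarrow>
     diversity X \<delta> \<and> Metric_space.mcomplete X (induced_dist X \<delta>)"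

definition polish_diversity :: "'a set \<Rightarrow> ('a set \<Rightarrow> real) \<Rightarrow> bool" where
  "polish_diversity X \<delta> \<longleftrightarrow> separable_diversity X \<delta> \<and> complete_diversity X \<delta>"

definition diversity_iso ::
  "'a set \<Rightarrow> ('a set \<Rightarrow> real) \<Rightarrow> 'b set \<Rightarrow> ('b set \<Rightarrow> real) \<Rightarrow> ('a \<Rightarrow> 'b) \<Rightarrow> bool" where
  "diversity_iso X \<delta>X Y \<delta>Y \<phi> \<longleftrightarrow>
     bij_betw \<phi> X Y \<and> (\<forall>A\<in>Fpow X. \<delta>Y (\<phi> ` A) = \<delta>X A)"

definition isomorphic_diversities ::
  "'a set \<Rightarrow> ('a set \<Rightarrow> real) \<Rightarrow> 'b set \<Rightarrow> ('b set \<Rightarrow> real) \<Rightarrow> bool" where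
  "isomorphic_diversities X \<delta>X Y \<delta>Y \<longleftrightarrow> (\<exists>\<phi>. diversity_iso X \<delta>X Y \<delta>Y \<phi>)"

section \<open>Admissible functions\<close>

text \<open>The extra point may have to lie outside \<open>X\<close>, and \<open>X\<close> may be all of its type.  So \<open>X\<close> is
  copied into the option type: \<open>z = Some x\<close> with \<open>x \<in> X\<close> is a point of \<open>X\<close>, and
  \<open>z = None\<close> is a new one.\<close>

definition admissible :: "'a set \<Rightarrow> ('a set \<Rightarrow> real) \<Rightarrow> ('a set \<Rightarrow> real) \<Rightarrow> bool" where
  "admissible X \<delta> f \<longleftrightarrow>
     (\<exists>(z :: 'a option) \<delta>'. diversity (insert z (Some ` X)) \<delta>' \<and>
        (\<forall>A\<in>Fpow X. \<delta>' (Some ` A) = \<delta> A \<and> \<delta>' (insert z (Some ` A)) = f A))"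

text \<open>Functions on \<open>Fpow X\<close> are taken extensional, so that equality in HOL is equality on
  \<open>Fpow X\<close>.\<close>

definition E :: "'a set \<Rightarrow> ('a set \<Rightarrow> real) \<Rightarrow> ('a set \<Rightarrow> real) set" where
  "E X \<delta> = {f \<in> extensional (Fpow X). admissible X \<delta> f}"

text \<open>Families \<open>(A\<^sub>i)\<close> are indexed by the functions \<open>f\<^sub>i\<close> themselves.\<close>

definition hat :: "'a set \<Rightarrow> ('a set \<Rightarrow> real) set \<Rightarrow> real" where
  "hat X F =
     (if card F \<le> 1 then 0
      else Max ((\<lambda>f. SUP A \<in> F \<rightarrow> Fpow X.
                   f (\<Union>g\<in>F - {f}. A g) - (\<Sum>g\<in>F - {f}. g (A g))) ` F))"

definition kappa :: "'a set \<Rightarrow> ('a set \<Rightarrow> real) \<Rightarrow> 'a \<Rightarrow> 'a set \<Rightarrow> real" where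
  "kappa X \<delta> x = (\<lambda>A\<in>Fpow X. \<delta> (insert x A))"

definition support_extension ::
  "'a set \<Rightarrow> ('a set \<Rightarrow> real) \<Rightarrow> 'a set \<Rightarrow> ('a set \<Rightarrow> real) \<Rightarrow> 'a set \<Rightarrow> real" where
  "support_extension X \<delta> S f =
     (\<lambda>A\<in>Fpow X. Inf {f B + (\<Sum>b\<in>B. \<delta> (insert b (P b))) | B P.
                        B \<in> Fpow S \<and> (\<Union>b\<in>B. P b) = A})"

definition E_omega :: "'a set \<Rightarrow> ('a set \<Rightarrow> real) \<Rightarrow> ('a set \<Rightarrow> real) set" where
  "E_omega X \<delta> =
     {g \<in> E X \<delta>. \<exists>S f. finite S \<and> S \<noteq> {} \<and> S \<subseteq> X \<and> f \<in> E S \<delta> \<and>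
                       g = support_extension X \<delta> S f}"

section \<open>The tower and its union\<close>

text \<open>All \<open>X\<^sub>n\<close> live in one type, so that the identification of \<open>X\<^sub>n\<close> with its image in
  \<open>X\<^sub>n\<^sub>+\<^sub>1\<close> becomes an inclusion and the direct limit becomes a union.  A function
  \<open>g \<in> E_omega X\<^sub>n \<delta>\<^sub>n\<close> is represented by the point \<open>name n X\<^sub>n \<delta>\<^sub>n g\<close>: by \<open>x\<close> if
  \<open>g = \<kappa>\<^sub>x\<close>, and otherwise by a fresh point \<open>New n xs rs\<close>, where \<open>xs\<close> enumerates a
  support \<open>S\<close> of \<open>g\<close> and \<open>rs\<close> lists the values on the subsets of \<open>S\<close> of a function
  \<open>f\<close> with \<open>g = f\<^sub>S\<^sup>X\<close>.  The tag \<open>n\<close> keeps new points apart from old ones.  The choice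
  of \<open>xs\<close> and \<open>rs\<close> is immaterial, since \<open>name n X\<^sub>n \<delta>\<^sub>n\<close> is injective on
  \<open>E_omega X\<^sub>n \<delta>\<^sub>n\<close>: see \<open>inj_on_name\<close> and \<open>level_fresh\<close> below.\<close>

datatype 'a point = Base 'a | New nat "'a point list" "real list"

definition new_name ::
  "nat \<Rightarrow> 'a point set \<Rightarrow> ('a point set \<Rightarrow> real) \<Rightarrow> ('a point set \<Rightarrow> real) \<Rightarrow> 'a point" where
  "new_name n X \<delta> g =
     (SOME p. \<exists>xs f. p = New n xs (map (\<lambda>ys. f (set ys)) (subseqs xs)) \<and>
                     xs \<noteq> [] \<and> set xs \<subseteq> X \<and> f \<in> E (set xs) \<delta> \<and>
                     g = support_extension X \<delta> (set xs) f)"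

definition name ::
  "nat \<Rightarrow> 'a point set \<Rightarrow> ('a point set \<Rightarrow> real) \<Rightarrow> ('a point set \<Rightarrow> real) \<Rightarrow> 'a point" where
  "name n X \<delta> g =
     (if g \<in> kappa X \<delta> ` X then inv_into X (kappa X \<delta>) g else new_name n X \<delta> g)"

primrec level :: "'a set \<Rightarrow> ('a set \<Rightarrow> real) \<Rightarrow> nat \<Rightarrow>
    'a point set \<times> ('a point set \<Rightarrow> real)" where
  "level X \<delta> 0 = (Base ` X, \<lambda>A. \<delta> (Base -` A))"
| "level X \<delta> (Suc n) =
     (let (Xn, \<delta>n) = level X \<delta> n in
       (name n Xn \<delta>n ` E_omega Xn \<delta>n,
        \<lambda>A. hat Xn {g \<in> E_omega Xn \<delta>n. name n Xn \<delta>n g \<in> A}))"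

definition omega_set :: "'a set \<Rightarrow> ('a set \<Rightarrow> real) \<Rightarrow> 'a point set" where
  "omega_set X \<delta> = (\<Union>n. fst (level X \<delta> n))"

definition omega_div :: "'a set \<Rightarrow> ('a set \<Rightarrow> real) \<Rightarrow> 'a point set \<Rightarrow> real" where
  "omega_div X \<delta> A = snd (level X \<delta> (LEAST n. A \<subseteq> fst (level X \<delta> n))) A"

lemma diversity_singleton_eq:
  assumes "diversity X \<delta>" "x \<in> X" "y \<in> X" "\<delta> {x, y} = \<delta> {y}"
  shows "x = y"
proof (rule ccontr)
  assume "x \<noteq> y"
  have "{x, y} \<in> Fpow X" "{y} \<in> Fpow X"
    using assms by (auto simp: Fpow_def)
  then have "\<delta> {y} = 0" "\<delta> {x, y} \<noteq> 0"
    using assms(1) \<open>x \<noteq> y\<close> by (auto simp: diversity_def)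
  then show False
    using assms(4) by simp
qed

lemma inj_on_kappa:
  assumes "diversity X \<delta>"
  shows "inj_on (kappa X \<delta>) X"
proof (rule inj_onI)
  fix x y
  assume xy: "x \<in> X" "y \<in> X" "kappa X \<delta> x = kappa X \<delta> y"
  have "{y} \<in> Fpow X"
    using xy by (auto simp: Fpow_def)
  then have "\<delta> {x, y} = \<delta> {y}"
    using fun_cong[OF xy(3), of "{y}"] by (simp add: kappa_def)
  then show "x = y"
    using diversity_singleton_eq assms xy by metis
qed

lemma name_kappa:
  assumes "diversity X \<delta>" "x \<in> X"
  shows "name n X \<delta> (kappa X \<delta> x) = x"
  using assms inj_on_kappa[OF assms(1)] by (simp add: name_def)

lemma new_name_props:
  assumes "g \<in> E_omega X \<delta>"
  obtains xs f where "new_name n X \<delta> g = New n xs (map (\<lambda>ys. f (set ys)) (subseqs xs))"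
    "f \<in> E (set xs) \<delta>" "g = support_extension X \<delta> (set xs) f"
proof -
  obtain S f where S: "finite S" "S \<noteq> {}" "S \<subseteq> X" "f \<in> E S \<delta>" "g = support_extension X \<delta> S f"
    using assms by (auto simp: E_omega_def)
  obtain xs where "set xs = S"
    using finite_list S(1) by blast
  then have "\<exists>p xs f. p = New n xs (map (\<lambda>ys. f (set ys)) (subseqs xs)) \<and>
                     xs \<noteq> [] \<and> set xs \<subseteq> X \<and> f \<in> E (set xs) \<delta> \<and>
                     g = support_extension X \<delta> (set xs) f"
    using S by auto
  from someI_ex[OF this] show ?thesis
    using that unfolding new_name_def by blast
qed

lemma new_name_inject:
  assumes g: "g \<in> E_omega X \<delta>" and h: "h \<in> E_omega X \<delta>"
    and eq: "new_name n X \<delta> g = new_name n X \<delta> h"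
  shows "g = h"
proof -
  obtain xs f where f: "new_name n X \<delta> g = New n xs (map (\<lambda>ys. f (set ys)) (subseqs xs))"
    "f \<in> E (set xs) \<delta>" "g = support_extension X \<delta> (set xs) f"
    using new_name_props[OF g] by blast
  obtain xs' f' where f': "new_name n X \<delta> h = New n xs' (map (\<lambda>ys. f' (set ys)) (subseqs xs'))"
    "f' \<in> E (set xs') \<delta>" "h = support_extension X \<delta> (set xs') f'"
    using new_name_props[OF h] by blast
  have xs: "xs' = xs" and val: "\<forall>ys\<in>set (subseqs xs). f (set ys) = f' (set ys)"
    using eq f(1) f'(1) by auto
  have "f A = f' A" if "A \<in> Fpow (set xs)" for A
  proof -
    have "A \<in> set ` set (subseqs xs)"
      using that by (auto simp: subseqs_powset Fpow_def)
    then show ?thesis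
      using val by auto
  qed
  moreover have "f \<in> extensional (Fpow (set xs))" "f' \<in> extensional (Fpow (set xs))"
    using f(2) f'(2) xs by (auto simp: E_def)
  ultimately have "f = f'"
    by (metis extensionalityI)
  then show ?thesis
    using f(3) f'(3) xs by simp
qed

lemma inj_on_name:
  assumes fresh: "\<And>xs rs. New n xs rs \<notin> X"
  shows "inj_on (name n X \<delta>) (E_omega X \<delta>)"
proof (rule inj_onI)
  fix g h
  assume g: "g \<in> E_omega X \<delta>" and h: "h \<in> E_omega X \<delta>"
    and eq: "name n X \<delta> g = name n X \<delta> h"
  have old: "name n X \<delta> k \<in> X \<and> kappa X \<delta> (name n X \<delta> k) = k" if "k \<in> kappa X \<delta> ` X" for k
    using that by (auto simp: name_def inv_into_into f_inv_into_f)
  have new: "name n X \<delta> k \<notin> X" if "k \<in> E_omega X \<delta>" "k \<notin> kappa X \<delta> ` X" for k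
    using that fresh new_name_props[OF that(1), of n] by (metis name_def)
  show "g = h"
  proof (cases "g \<in> kappa X \<delta> ` X")
    case True
    then have "h \<in> kappa X \<delta> ` X"
      using old new eq h by metis
    then show ?thesis
      using True old eq by metis
  next
    case False
    then have "h \<notin> kappa X \<delta> ` X"
      using old new eq g by metis
    then show ?thesis
      using False eq new_name_inject[OF g h] by (simp add: name_def)
  qed
qed

lemma level_fresh:
  assumes "n \<le> m"
  shows "New m xs rs \<notin> fst (level X \<delta> n)"
  using assms
proof (induction n arbitrary: xs rs)
  case 0
  then show ?case by auto
next
  case (Suc n)
  obtain Xn \<delta>n where lev: "level X \<delta> n = (Xn, \<delta>n)"
    by fastforce
  have IH: "New m xs rs \<notin> Xn"
    using Suc lev by (metis Suc_leD fst_conv)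
  have "name n Xn \<delta>n g \<noteq> New m xs rs" if "g \<in> E_omega Xn \<delta>n" for g
  proof (cases "g \<in> kappa Xn \<delta>n ` Xn")
    case True
    then show ?thesis
      using IH inv_into_into[OF True] by (auto simp: name_def)
  next
    case False
    then show ?thesis
      using Suc.prems new_name_props[OF that, of n] by (metis name_def not_less_eq_eq order_refl point.inject(2))
  qed
  then show ?case
    using lev by (force simp: Let_def)
qed

section \<open>Completion\<close>

text \<open>Points of the completion are Cauchy sequences modulo distance tending to 0.
  A diversity function is 1-Lipschitz in each argument, so its continuous extension to the classes
  of \<open>s\<^sub>1, \<dots>, s\<^sub>k\<close> is the limit of \<open>\<delta> {s\<^sub>1 n, \<dots>, s\<^sub>k n}\<close>, whatever the
  representatives.\<close>

definition cauchy_rel :: "'a set \<Rightarrow> ('a set \<Rightarrow> real) \<Rightarrow> ((nat \<Rightarrow> 'a) \<times> (nat \<Rightarrow> 'a)) set" where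
  "cauchy_rel X \<delta> =
     {(s, t). Metric_space.MCauchy X (induced_dist X \<delta>) s \<and>
              Metric_space.MCauchy X (induced_dist X \<delta>) t \<and>
              (\<lambda>n. induced_dist X \<delta> (s n) (t n)) \<longlonglongrightarrow> 0}"

definition completion_set :: "'a set \<Rightarrow> ('a set \<Rightarrow> real) \<Rightarrow> (nat \<Rightarrow> 'a) set set" where
  "completion_set X \<delta> = {s. Metric_space.MCauchy X (induced_dist X \<delta>) s} // cauchy_rel X \<delta>"

definition completion_div :: "('a set \<Rightarrow> real) \<Rightarrow> (nat \<Rightarrow> 'a) set set \<Rightarrow> real" where
  "completion_div \<delta> F = lim (\<lambda>n. \<delta> ((\<lambda>c. (SOME s. s \<in> c) n) ` F))"

section \<open>The diversity built from a single point\<close>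

definition U_set :: "(nat \<Rightarrow> unit point) set set" where
  "U_set = completion_set (omega_set {()} (\<lambda>_. 0)) (omega_div {()} (\<lambda>_. 0))"

definition U_div :: "(nat \<Rightarrow> unit point) set set \<Rightarrow> real" where
  "U_div = completion_div (omega_div {()} (\<lambda>_. 0))"

end

theory Submission
  imports Defs
begin

text \<open>
  A function \<open>f\<close> is admissible iff \<open>f {} = 0\<close>, \<open>\<delta> A \<le> f A\<close>, \<open>f (A \<union> B) \<le> f A + f B\<close>, and
  \<open>f (A \<union> B) \<le> f (A \<union> C) + \<delta> (B \<union> C)\<close> for \<open>C \<noteq> {}\<close>.  With these conditions every admissible
  function on a finite subset of some \<open>X\<^sub>n\<close> is realised exactly by a point of \<open>X\<^sub>n\<^sub>+\<^sub>1\<close>, so a dense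
  sequence of a separable diversity embeds point by point into \<open>X\<^sub>\<omega>\<close>, and the embedding extends by
  continuity into the completion.  Separability of \<open>X\<^sub>n\<close> passes to \<open>X\<^sub>n\<^sub>+\<^sub>1\<close> because a finitely
  supported function changes little when its support is moved into a dense set, after which finitely
  many rounded values determine it up to a small error.
\<close>

section \<open>Diversities and admissible functions\<close>

text \<open>The whole of E(X) is too big to iterate. Let \<open>\<delta>\<close> be 1 on all sets
  with at least two points of a countably infinite X, and let h take the values 1 and 2 on X. The
  function that is 0 on the empty set and otherwise the maximum of h on A is admissible, and
  distinct h give functions at distance at least 1, so E(X) is not separable. Finite support removes
  this obstacle and still leaves enough functions, because an embedding built point by point meets
  only finite sets. The extension property is used in X_omega, before completing. There it is exact,
  so no errors accumulate along the sequence, and the completion only has to carry equalities of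
  \<open>\<delta>\<close> on finite sets to the limit. One estimate,
  \<open>lip_functional_UN\<close>, stands behind most others: trading sets P i for single points y
  i changes the value by at most the sum of \<open>\<delta> (insert (y i) (P i))\<close>. It bounds
  \<open>hat\<close> on embedded points, compares covers in \<open>support_extension\<close>, moves
  supports, and gives the continuity of \<open>\<delta>\<close>.\<close>

lemma Fpow_iff: "A \<in> Fpow X \<longleftrightarrow> A \<subseteq> X \<and> finite A"
  by (auto simp: Fpow_def)

text \<open>D2 reduces to the last two hypotheses: \<open>A \<union> C\<close> lies inside the union
  of \<open>A \<union> B\<close> and \<open>B \<union> C\<close>, and these share a point of
  \<open>B\<close>. Positivity is asked only of pairs, because monotonicity passes it on to larger
  sets.\<close>

lemma diversityI:
  assumes empty: "\<delta> {} = 0"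
    and single: "\<And>x. x \<in> X \<Longrightarrow> \<delta> {x} = 0"
    and pair: "\<And>x y. x \<in> X \<Longrightarrow> y \<in> X \<Longrightarrow> x \<noteq> y \<Longrightarrow> \<delta> {x, y} > 0"
    and mono: "\<And>A B. B \<in> Fpow X \<Longrightarrow> A \<subseteq> B \<Longrightarrow> \<delta> A \<le> \<delta> B"
    and join: "\<And>A B x. A \<in> Fpow X \<Longrightarrow> B \<in> Fpow X \<Longrightarrow> x \<in> A \<Longrightarrow> x \<in> B \<Longrightarrow> \<delta> (A \<union> B) \<le> \<delta> A + \<delta> B"
  shows "diversity X \<delta>"
  unfolding diversity_def
proof (intro conjI ballI impI)
  fix A assume A: "A \<in> Fpow X"
  show "0 \<le> \<delta> A"
    using mono[OF A, of "{}"] empty by simp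
  show "\<delta> A = 0 \<longleftrightarrow> card A \<le> 1"
  proof
    assume zero: "\<delta> A = 0"
    have "x = y" if "x \<in> A" "y \<in> A" for x y
    proof (rule ccontr)
      assume "x \<noteq> y"
      then have "\<delta> {x, y} > 0"
        using A that by (intro pair) (auto simp: Fpow_iff)
      moreover have "\<delta> {x, y} \<le> \<delta> A"
        using A that by (intro mono) auto
      ultimately show False
        using zero by simp
    qed
    then show "card A \<le> 1"
      using A by (auto simp: Fpow_iff card_le_Suc0_iff_eq)
  next
    assume "card A \<le> 1"
    then have "A = {} \<or> (\<exists>x. A = {x})"
      using A by (auto simp: Fpow_iff le_Suc_eq card_1_singleton_iff)
    then show "\<delta> A = 0"
      using A empty single by (auto simp: Fpow_iff)
  qed
next
  fix A B C assume ABC: "A \<in> Fpow X" "B \<in> Fpow X" "C \<in> Fpow X" and "B \<noteq> {}"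
  then obtain b where b: "b \<in> B"
    by auto
  have "\<delta> (A \<union> C) \<le> \<delta> ((A \<union> B) \<union> (B \<union> C))"
    using ABC by (intro mono) (auto simp: Fpow_iff)
  also have "\<dots> \<le> \<delta> (A \<union> B) + \<delta> (B \<union> C)"
    using ABC b by (intro join[of _ _ b]) (auto simp: Fpow_iff)
  finally show "\<delta> (A \<union> C) \<le> \<delta> (A \<union> B) + \<delta> (B \<union> C)" .
qed

text \<open>This is D2 for a set function with a hidden extra point that stays beside
  \<open>A\<close>. Both \<open>\<delta>\<close> itself, with nothing hidden, and the admissible
  functions satisfy it, so the same estimates serve both.\<close>

definition lip_functional :: "'a set \<Rightarrow> ('a set \<Rightarrow> real) \<Rightarrow> ('a set \<Rightarrow> real) \<Rightarrow> bool" where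
  "lip_functional X \<delta> f \<longleftrightarrow>
     (\<forall>A\<in>Fpow X. \<forall>B\<in>Fpow X. \<forall>C\<in>Fpow X. C \<noteq> {} \<longrightarrow> f (A \<union> B) \<le> f (A \<union> C) + \<delta> (B \<union> C))"

lemma lip_functional_insert:
  assumes "lip_functional X \<delta> f" "A \<in> Fpow X" "B \<in> Fpow X" "c \<in> X"
  shows "f (A \<union> B) \<le> f (insert c A) + \<delta> (insert c B)"
proof -
  have "{c} \<in> Fpow X" "{c} \<noteq> {}"
    using assms by (auto simp: Fpow_iff)
  then have "f (A \<union> B) \<le> f (A \<union> {c}) + \<delta> (B \<union> {c})"
    using assms unfolding lip_functional_def by blast
  then show ?thesis
    by simp
qed

text \<open>Each induction step trades one piece \<open>P i\<close> for the point
  \<open>y i\<close>. The set \<open>R\<close> holds what stays untouched and has to vary, since a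
  piece not yet traded waits there. Singleton pieces move points; general pieces bound the costs in
  \<open>support_extension\<close>.\<close>

lemma lip_functional_UN:
  assumes f: "lip_functional X \<delta> f" and "finite I" and "R \<in> Fpow X"
    and "\<And>i. i \<in> I \<Longrightarrow> P i \<in> Fpow X" and "\<And>i. i \<in> I \<Longrightarrow> y i \<in> X"
  shows "f (R \<union> (\<Union>i\<in>I. P i)) \<le> f (R \<union> y ` I) + (\<Sum>i\<in>I. \<delta> (insert (y i) (P i)))"
  using assms(2-)
proof (induction I arbitrary: R rule: finite_induct)
  case empty
  then show ?case by simp
next
  case (insert j I)
  have fin: "R \<union> P j \<in> Fpow X" "R \<union> y ` I \<in> Fpow X" "P j \<in> Fpow X" "y j \<in> X"
    using insert by (auto simp: Fpow_iff)
  have "f (R \<union> P j \<union> (\<Union>i\<in>I. P i)) \<le> f (R \<union> P j \<union> y ` I) + (\<Sum>i\<in>I. \<delta> (insert (y i) (P i)))"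
    using insert fin by (intro insert.IH) auto
  also have "f (R \<union> P j \<union> y ` I) = f ((R \<union> y ` I) \<union> P j)"
    by (simp add: Un_ac)
  also have "\<dots> \<le> f (insert (y j) (R \<union> y ` I)) + \<delta> (insert (y j) (P j))"
    using fin by (intro lip_functional_insert[OF f])
  finally show ?case
    using insert by (simp add: Un_ac)
qed

context
  fixes X :: "'a set" and \<delta> :: "'a set \<Rightarrow> real"
  assumes div: "diversity X \<delta>"
begin

lemma diversity_zero: "A \<in> Fpow X \<Longrightarrow> \<delta> A = 0 \<longleftrightarrow> card A \<le> 1"
  and diversity_nonneg: "A \<in> Fpow X \<Longrightarrow> 0 \<le> \<delta> A"
  using div by (auto simp: diversity_def)

lemma diversity_empty: "\<delta> {} = 0"
  and diversity_single: "x \<in> X \<Longrightarrow> \<delta> {x} = 0"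
  by (simp_all add: diversity_zero Fpow_iff)

lemma diversity_pair: "x \<in> X \<Longrightarrow> y \<in> X \<Longrightarrow> \<delta> {x, y} = 0 \<longleftrightarrow> x = y"
  by (simp add: diversity_zero Fpow_iff card_insert_if)

lemma diversity_lip: "lip_functional X \<delta> \<delta>"
  unfolding lip_functional_def
proof (intro ballI impI)
  fix A B C assume "A \<in> Fpow X" "B \<in> Fpow X" "C \<in> Fpow X" "C \<noteq> {}"
  then have "\<delta> (A \<union> B) \<le> \<delta> (A \<union> C) + \<delta> (C \<union> B)"
    using div by (simp add: diversity_def)
  then show "\<delta> (A \<union> B) \<le> \<delta> (A \<union> C) + \<delta> (B \<union> C)"
    by (simp add: Un_commute)
qed

text \<open>The points of \<open>B\<close> outside \<open>A\<close> are dropped one at a time;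
  dropping d costs \<open>\<delta> {d}\<close>, which is 0.\<close>

lemma lip_functional_mono:
  assumes f: "lip_functional X \<delta> f" and "B \<in> Fpow X" "A \<subseteq> B"
  shows "f A \<le> f B"
proof -
  have "finite (B - A)"
    using assms by (auto simp: Fpow_iff)
  moreover have "f A \<le> f (A \<union> D)" if "finite D" "D \<subseteq> B" for D
    using that
  proof (induction D rule: finite_induct)
    case (insert d D)
    have "f ((A \<union> D) \<union> {}) \<le> f (insert d (A \<union> D)) + \<delta> (insert d {})"
      using insert assms by (intro lip_functional_insert[OF f]) (auto simp: Fpow_iff finite_subset)
    moreover have "\<delta> {d} = 0"
      using insert assms by (intro diversity_single) (auto simp: Fpow_iff)
    ultimately show ?case
      using insert by simp
  qed simp
  moreover have "A \<union> (B - A) = B"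
    using assms by auto
  ultimately show ?thesis
    by (metis Diff_subset)
qed

lemmas diversity_mono = lip_functional_mono[OF diversity_lip]

lemma diversity_join:
  assumes "A \<in> Fpow X" "B \<in> Fpow X" "x \<in> A" "x \<in> B"
  shows "\<delta> (A \<union> B) \<le> \<delta> A + \<delta> B"
  using lip_functional_insert[OF diversity_lip assms(1,2), of x] assms
  by (auto simp: insert_absorb Fpow_iff)

end

section \<open>Admissibility without the extra point\<close>

definition adm :: "'a set \<Rightarrow> ('a set \<Rightarrow> real) \<Rightarrow> ('a set \<Rightarrow> real) \<Rightarrow> bool" where
  "adm X \<delta> f \<longleftrightarrow> f {} = 0 \<and> (\<forall>A\<in>Fpow X. \<delta> A \<le> f A) \<and> lip_functional X \<delta> f \<and>
     (\<forall>A\<in>Fpow X. \<forall>B\<in>Fpow X. f (A \<union> B) \<le> f A + f B)"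

lemma adm_empty: "adm X \<delta> f \<Longrightarrow> f {} = 0"
  and adm_ge: "adm X \<delta> f \<Longrightarrow> A \<in> Fpow X \<Longrightarrow> \<delta> A \<le> f A"
  and adm_lip: "adm X \<delta> f \<Longrightarrow> lip_functional X \<delta> f"
  and adm_subadd: "adm X \<delta> f \<Longrightarrow> A \<in> Fpow X \<Longrightarrow> B \<in> Fpow X \<Longrightarrow> f (A \<union> B) \<le> f A + f B"
  by (auto simp: adm_def)

text \<open>Read the axioms of the extension with the extra point z put into the sets:
  \<open>{z}\<close> is a singleton, \<open>insert z A\<close> contains \<open>A\<close>, the sets
  \<open>insert z A\<close> and \<open>insert z B\<close> share z, and D2 with z beside the first
  set is \<open>lip_functional\<close>.\<close>

lemma admissible_imp_adm:
  assumes "admissible X \<delta> f"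
  shows "adm X \<delta> f"
proof -
  obtain z \<delta>' where d: "diversity (insert z (Some ` X)) \<delta>'"
    and A: "\<And>A. A \<in> Fpow X \<Longrightarrow> \<delta>' (Some ` A) = \<delta> A"
    and f: "\<And>A. A \<in> Fpow X \<Longrightarrow> \<delta>' (insert z (Some ` A)) = f A"
    using assms unfolding admissible_def by blast
  let ?X = "insert z (Some ` X)"
  have in1: "Some ` A \<in> Fpow ?X" "insert z (Some ` A) \<in> Fpow ?X" if "A \<in> Fpow X" for A
    using that by (auto simp: Fpow_iff)
  have un: "A \<union> B \<in> Fpow X" if "A \<in> Fpow X" "B \<in> Fpow X" for A B
    using that by (auto simp: Fpow_iff)
  have "f {} = 0"
    using f[of "{}"] diversity_single[OF d, of z] by (simp add: Fpow_iff)
  moreover have "\<delta> A \<le> f A" if "A \<in> Fpow X" for A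
    using diversity_mono[OF d in1(2)[OF that], of "Some ` A"] A f that by auto
  moreover have "f (A \<union> B) \<le> f A + f B" if "A \<in> Fpow X" "B \<in> Fpow X" for A B
    using diversity_join[OF d in1(2)[OF that(1)] in1(2)[OF that(2)], of z] that un
    by (simp add: f[symmetric] image_Un)
  moreover have "lip_functional X \<delta> f"
    unfolding lip_functional_def
  proof (intro ballI impI)
    fix B C D assume *: "B \<in> Fpow X" "C \<in> Fpow X" "D \<in> Fpow X" "D \<noteq> {}"
    have "\<delta>' (insert z (Some ` B) \<union> Some ` C) \<le> \<delta>' (insert z (Some ` B) \<union> Some ` D) + \<delta>' (Some ` C \<union> Some ` D)"
      using diversity_lip[OF d] in1 * unfolding lip_functional_def by (simp del: Un_insert_left)
    then show "f (B \<union> C) \<le> f (B \<union> D) + \<delta> (C \<union> D)"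
      using * un by (simp add: f[symmetric] A[symmetric] image_Un)
  qed
  ultimately show ?thesis
    unfolding adm_def by blast
qed

context
  fixes X :: "'a set" and \<delta> :: "'a set \<Rightarrow> real"
  assumes div: "diversity X \<delta>"
begin

lemma adm_mono: "adm X \<delta> f \<Longrightarrow> B \<in> Fpow X \<Longrightarrow> A \<subseteq> B \<Longrightarrow> f A \<le> f B"
  using lip_functional_mono[OF div adm_lip] .

lemma adm_nonneg: "adm X \<delta> f \<Longrightarrow> A \<in> Fpow X \<Longrightarrow> 0 \<le> f A"
  using adm_ge diversity_nonneg[OF div] by fastforce

text \<open>Distance 0 to x forces the extra point to be x itself. The upper bound trades
  \<open>A\<close> for x; the lower one combines \<open>\<delta> \<le> f\<close> with
  subadditivity.\<close>

lemma adm_zero_imp_kappa: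
  assumes f: "adm X \<delta> f" and x: "x \<in> X" "f {x} = 0" and A: "A \<in> Fpow X"
  shows "f A = \<delta> (insert x A)"
proof (rule antisym)
  show "f A \<le> \<delta> (insert x A)"
    using lip_functional_insert[OF adm_lip[OF f], of "{}" A x] x A by (simp add: Fpow_iff)
  have "\<delta> (insert x A) \<le> f ({x} \<union> A)"
    using adm_ge[OF f, of "insert x A"] x A by (simp add: Fpow_iff)
  also have "\<dots> \<le> f {x} + f A"
    using x A by (intro adm_subadd[OF f]) (auto simp: Fpow_iff)
  finally show "\<delta> (insert x A) \<le> f A"
    using x by simp
qed

text \<open>D1 decides where the extra point lies. If f vanishes on a singleton {x}, a new point
  would be at distance 0 from x, so x itself has to serve, and \<open>adm_zero_imp_kappa\<close>
  shows that it does. Otherwise f is positive on all singletons and the point can be new.\<close>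

lemma adm_imp_admissible:
  assumes f: "adm X \<delta> f"
  shows "admissible X \<delta> f"
proof (cases "\<exists>x\<in>X. f {x} = 0")
  case True
  then obtain x where x: "x \<in> X" "f {x} = 0"
    by blast
  have vim: "Some -` A \<in> Fpow X" if "A \<in> Fpow (Some ` X)" for A
    using that by (auto simp: Fpow_iff finite_vimageI)
  have "diversity (Some ` X) (\<lambda>A. \<delta> (Some -` A))"
  proof (rule diversityI)
    fix A B :: "'a option set" and z assume "A \<in> Fpow (Some ` X)" "B \<in> Fpow (Some ` X)" "z \<in> A" "z \<in> B"
    then show "\<delta> (Some -` (A \<union> B)) \<le> \<delta> (Some -` A) + \<delta> (Some -` B)"
      using diversity_join[OF div vim vim, of A B "the z"] by (auto simp: Fpow_iff)
  next
    fix a b assume "a \<in> Some ` X" "b \<in> Some ` X" "a \<noteq> b"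
    then obtain x y where xy: "x \<in> X" "y \<in> X" "x \<noteq> y" "Some -` {a, b} = {x, y}"
      by auto
    then show "0 < \<delta> (Some -` {a, b})"
      using diversity_pair[OF div xy(1,2)] diversity_nonneg[OF div, of "{x, y}"] by (simp add: Fpow_iff)
  next
    fix a assume "a \<in> Some ` X"
    moreover have "Some -` {Some x} = {x}" for x :: 'a
      by auto
    ultimately show "\<delta> (Some -` {a}) = 0"
      using diversity_single[OF div] by auto
  next
    fix A B assume "B \<in> Fpow (Some ` X)" "A \<subseteq> B"
    then show "\<delta> (Some -` A) \<le> \<delta> (Some -` B)"
      by (intro diversity_mono[OF div vim] vimage_mono)
  qed (simp add: diversity_empty[OF div])
  moreover have "insert (Some x) (Some ` X) = Some ` X"
    using x by auto
  moreover have "Some -` (insert (Some x) (Some ` A)) = insert x A" for A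
    by auto
  ultimately show ?thesis
    using adm_zero_imp_kappa[OF f x] unfolding admissible_def
    by (intro exI[of _ "Some x"] exI[of _ "\<lambda>A. \<delta> (Some -` A)"]) (auto simp: inj_vimage_image_eq)
next
  case False
  define \<delta>' where "\<delta>' A = (if None \<in> A then f (Some -` A) else \<delta> (Some -` A))" for A
  have vim: "Some -` A \<in> Fpow X" if "A \<in> Fpow (insert None (Some ` X))" for A
    using that by (auto simp: Fpow_iff finite_vimageI)
  have pos: "f {x} > 0" if "x \<in> X" for x
    using adm_nonneg[OF f, of "{x}"] that False by (force simp: Fpow_iff)
  have "diversity (insert None (Some ` X)) \<delta>'"
  proof (rule diversityI)
    fix A B assume B: "B \<in> Fpow (insert None (Some ` X))" and "A \<subseteq> B"
    then have AB: "Some -` A \<subseteq> Some -` B" by auto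
    have "Some -` A \<in> Fpow X"
      using vim[OF B] AB by (auto simp: Fpow_iff finite_subset)
    then show "\<delta>' A \<le> \<delta>' B"
      using adm_mono[OF f vim[OF B] AB] diversity_mono[OF div vim[OF B] AB]
        adm_ge[OF f, of "Some -` A"] \<open>A \<subseteq> B\<close>
      by (auto simp: \<delta>'_def)
  next
    fix A B z assume A: "A \<in> Fpow (insert None (Some ` X))" and B: "B \<in> Fpow (insert None (Some ` X))"
      and z: "z \<in> A" "z \<in> B"
    let ?A = "Some -` A" and ?B = "Some -` B"
    note v = vim[OF A] vim[OF B]
    \<comment> \<open>Covers two sets that share an old point when exactly one of them contains the
      new one.\<close>
    have mix: "f (C \<union> D) \<le> f C + \<delta> D" if "x \<in> C" "x \<in> D" "C \<in> Fpow X" "D \<in> Fpow X" for C D x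
      using lip_functional_insert[OF adm_lip[OF f] that(3,4), of x] that
      by (auto simp: insert_absorb Fpow_iff)
    show "\<delta>' (A \<union> B) \<le> \<delta>' A + \<delta>' B"
    proof (cases z)
      case None
      then show ?thesis
        using z adm_subadd[OF f v] by (simp add: \<delta>'_def)
    next
      case (Some x)
      then have x: "x \<in> ?A" "x \<in> ?B"
        using z by auto
      show ?thesis
        using adm_subadd[OF f v] diversity_join[OF div v x] mix[OF x v] mix[OF x(2,1) v(2,1)]
        by (auto simp: \<delta>'_def Un_commute)
    qed
  next
    fix a b assume "a \<in> insert None (Some ` X)" "b \<in> insert None (Some ` X)" "a \<noteq> b"
    moreover have "0 < \<delta> {x, y}" if "x \<in> X" "y \<in> X" "x \<noteq> y" for x y
      using diversity_pair[OF div that(1,2)] diversity_nonneg[OF div, of "{x, y}"] that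
      by (simp add: Fpow_iff)
    moreover have "Some -` {None, Some x} = {x}" "Some -` {Some x, None} = {x}"
      "Some -` {Some x, Some y} = {x, y}" for x y :: 'a
      by auto
    ultimately show "0 < \<delta>' {a, b}"
      using pos by (auto simp: \<delta>'_def)
  next
    fix x assume "x \<in> insert None (Some ` X)"
    moreover have "Some -` {None} = ({} :: 'a set)" "Some -` {Some y} = {y}" for y :: 'a
      by auto
    ultimately show "\<delta>' {x} = 0"
      using adm_empty[OF f] diversity_single[OF div] by (auto simp: \<delta>'_def)
  qed (simp add: \<delta>'_def diversity_empty[OF div])
  moreover have "Some -` (insert None (Some ` A)) = A" for A :: "'a set"
    by auto
  ultimately show ?thesis
    unfolding admissible_def
    by (intro exI[of _ None] exI[of _ \<delta>']) (auto simp: \<delta>'_def inj_vimage_image_eq)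
qed

lemma E_iff: "f \<in> E X \<delta> \<longleftrightarrow> f \<in> extensional (Fpow X) \<and> adm X \<delta> f"
  using adm_imp_admissible admissible_imp_adm by (auto simp: E_def)

end

section \<open>The diversity of admissible functions\<close>

lemma bound_Max_SUP:
  fixes v :: "'a \<Rightarrow> 'c \<Rightarrow> real"
  assumes "finite F" "f \<in> F" "a \<in> S" "bdd_above (v f ` S)"
  shows "v f a \<le> Max ((\<lambda>f. SUP a\<in>S. v f a) ` F)"
  using assms by (intro order.trans[OF cSUP_upper Max_ge]) auto

context
  fixes X :: "'a set" and \<delta> :: "'a set \<Rightarrow> real"
  assumes div: "diversity X \<delta>" and nonempty: "X \<noteq> {}"
begin

lemma E_adm: "f \<in> E X \<delta> \<Longrightarrow> adm X \<delta> f"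
  using E_iff[OF div] by blast

lemmas E_empty = adm_empty[OF E_adm]
  and E_subadd = adm_subadd[OF E_adm]
  and E_lip = adm_lip[OF E_adm]
  and E_ge = adm_ge[OF E_adm]
  and E_mono = adm_mono[OF div E_adm]

lemma E_eqI:
  assumes "f \<in> E X \<delta>" "g \<in> E X \<delta>" "\<And>A. A \<in> Fpow X \<Longrightarrow> f A = g A"
  shows "f = g"
  using assms by (auto simp: E_def intro: extensionalityI)

text \<open>Go through x: f reaches \<open>A\<close> by way of x, and
  \<open>\<delta> (insert x A)\<close> is at most \<open>g {x} + g A\<close>. The error does not
  depend on \<open>A\<close>, which is what keeps the suprema in \<open>hat\<close> finite.\<close>

lemma E_diff_le:
  assumes f: "f \<in> E X \<delta>" and g: "g \<in> E X \<delta>" and x: "x \<in> X" and A: "A \<in> Fpow X"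
  shows "f A \<le> g A + (f {x} + g {x})"
proof -
  have "f ({} \<union> A) \<le> f (insert x {}) + \<delta> (insert x A)"
    using x A by (intro lip_functional_insert[OF E_lip[OF f]]) (auto simp: Fpow_iff)
  moreover have "\<delta> (insert x A) \<le> g ({x} \<union> A)"
    using x A E_ge[OF g, of "insert x A"] by (simp add: Fpow_iff)
  moreover have "g ({x} \<union> A) \<le> g {x} + g A"
    using x A by (intro E_subadd[OF g]) (auto simp: Fpow_iff)
  ultimately show ?thesis
    by simp
qed

lemma E_subadd_UN:
  assumes f: "f \<in> E X \<delta>" and "finite I" "\<And>i. i \<in> I \<Longrightarrow> A i \<in> Fpow X"
  shows "f (\<Union>i\<in>I. A i) \<le> (\<Sum>i\<in>I. f (A i))"
  using assms(2,3)
proof (induction I rule: finite_induct)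
  case (insert i I)
  then have "f (A i \<union> (\<Union>i\<in>I. A i)) \<le> f (A i) + f (\<Union>i\<in>I. A i)"
    by (intro E_subadd[OF f]) (auto simp: Fpow_iff)
  then show ?case
    using insert by fastforce
qed (simp add: E_empty[OF f])

text \<open>A \<open>SUP\<close> bounds its members only when the set is bounded above.
  Subadditivity splits f of the union, and \<open>E_diff_le\<close> compares each part with the term
  that is subtracted. For a one-element \<open>F\<close> both sides are 0.\<close>

lemma hat_ge:
  assumes F: "finite F" "F \<subseteq> E X \<delta>" and f: "f \<in> F" and A: "\<And>g. g \<in> F \<Longrightarrow> g \<noteq> f \<Longrightarrow> A g \<in> Fpow X"
  shows "f (\<Union>g\<in>F - {f}. A g) - (\<Sum>g\<in>F - {f}. g (A g)) \<le> hat X F"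
proof (cases "card F \<le> 1")
  case True
  then have "F = {f}"
    using F f by (metis One_nat_def card_le_Suc0_iff_eq is_singletonI' is_singleton_the_elem empty_iff singletonD)
  then show ?thesis
    using F E_empty[of f] by (simp add: hat_def)
next
  case False
  define v where "v f A = f (\<Union>g\<in>F - {f}. A g) - (\<Sum>g\<in>F - {f}. g (A g))"
    for f and A :: "('a set \<Rightarrow> real) \<Rightarrow> 'a set"
  obtain x where x: "x \<in> X"
    using nonempty by blast
  have "v f B \<le> (\<Sum>g\<in>F - {f}. f {x} + g {x})" if "B \<in> F \<rightarrow> Fpow X" for B
  proof -
    have "f (\<Union>g\<in>F - {f}. B g) \<le> (\<Sum>g\<in>F - {f}. f (B g))"
      using F f that by (intro E_subadd_UN) auto
    also have "\<dots> \<le> (\<Sum>g\<in>F - {f}. g (B g) + (f {x} + g {x}))"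
      using F f that x by (intro sum_mono E_diff_le) auto
    finally show ?thesis
      by (simp add: v_def sum.distrib)
  qed
  then have "bdd_above (v f ` (F \<rightarrow> Fpow X))"
    by (rule bdd_aboveI2)
  \<comment> \<open>Nothing is assumed about \<open>A\<close> at f, and that value never enters;
    resetting it gives a family on all of \<open>F\<close>.\<close>
  moreover have "A(f := {}) \<in> F \<rightarrow> Fpow X"
    using A by (auto simp: Fpow_iff)
  ultimately have "v f (A(f := {})) \<le> Max ((\<lambda>f. SUP A\<in>F \<rightarrow> Fpow X. v f A) ` F)"
    using F f by (intro bound_Max_SUP)
  also have "\<dots> = hat X F"
    using False by (simp add: hat_def v_def)
  finally show ?thesis
    by (simp add: v_def)
qed

lemma hat_le:
  assumes F: "finite F" "F \<subseteq> E X \<delta>" "F \<noteq> {}"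
    and le: "\<And>f A. f \<in> F \<Longrightarrow> A \<in> F \<rightarrow> Fpow X \<Longrightarrow> f (\<Union>g\<in>F - {f}. A g) \<le> c + (\<Sum>g\<in>F - {f}. g (A g))"
  shows "hat X F \<le> c"
proof (cases "card F \<le> 1")
  case True
  obtain f where f: "f \<in> F"
    using F by blast
  then have "F = {f}"
    using F True by (metis One_nat_def card_le_Suc0_iff_eq is_singletonI' is_singleton_the_elem empty_iff singletonD)
  then show ?thesis
    using le[OF f, of "\<lambda>_. {}"] F E_empty[of f] by (simp add: hat_def Fpow_iff)
next
  case False
  have "(\<lambda>_. {}) \<in> F \<rightarrow> Fpow X"
    by (auto simp: Fpow_iff)
  then show ?thesis
    using F False le unfolding hat_def
    by (auto intro!: cSUP_least simp: algebra_simps)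
qed

text \<open>A family on \<open>G\<close> extends to \<open>F\<close> by empty sets, which change
  neither the union nor, because \<open>g {} = 0\<close>, the sum. Empty \<open>G\<close> is
  separate, as \<open>hat_le\<close> asks for a nonempty set.\<close>

lemma hat_mono:
  assumes F: "finite F" "F \<subseteq> E X \<delta>" and "G \<subseteq> F"
  shows "hat X G \<le> hat X F"
proof (cases "G = {}")
  case True
  show ?thesis
  proof (cases "F = {}")
    case False
    then obtain f where "f \<in> F" by blast
    have "(\<Sum>g\<in>F - {f}. g {}) = 0"
      using F E_empty by (intro sum.neutral) auto
    then have "0 \<le> hat X F"
      using hat_ge[OF F \<open>f \<in> F\<close>, of "\<lambda>_. {}"] F E_empty[of f] \<open>f \<in> F\<close> by (auto simp: Fpow_iff)
    then show ?thesis
      using True by (simp add: hat_def)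
  qed (use True in simp)
next
  case False
  show ?thesis
  proof (rule hat_le)
    fix f A assume f: "f \<in> G" and A: "A \<in> G \<rightarrow> Fpow X"
    define B where "B g = (if g \<in> G then A g else {})" for g
    have "f (\<Union>g\<in>F - {f}. B g) - (\<Sum>g\<in>F - {f}. g (B g)) \<le> hat X F"
      using assms f A by (intro hat_ge) (auto simp: B_def Fpow_iff Pi_iff)
    moreover have "(\<Union>g\<in>F - {f}. B g) = (\<Union>g\<in>G - {f}. A g)"
      using \<open>G \<subseteq> F\<close> by (auto simp: B_def split: if_splits)
    moreover have "(\<Sum>g\<in>F - {f}. g (B g)) = (\<Sum>g\<in>G - {f}. g (A g))"
      using assms E_empty by (intro sum.mono_neutral_cong_right) (auto simp: B_def)
    ultimately show "f (\<Union>g\<in>G - {f}. A g) \<le> hat X F + (\<Sum>g\<in>G - {f}. g (A g))"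
      by simp
  qed (use assms False in \<open>auto intro: finite_subset\<close>)
qed

text \<open>The triangle inequality through the common element k. The sets indexed by
  \<open>H - F\<close> are lumped together as \<open>C\<close>; the inequality of \<open>H\<close>
  with k leading bounds \<open>k C\<close>; then \<open>C\<close> is charged to k within the
  inequality of \<open>F\<close>. Since \<open>F\<close> and \<open>H\<close> can be exchanged,
  treating f in \<open>F\<close> suffices.\<close>

lemma hat_join_aux:
  assumes F: "finite F" "F \<subseteq> E X \<delta>" and H: "finite H" "H \<subseteq> E X \<delta>"
    and k: "k \<in> F" "k \<in> H" and f: "f \<in> F" and A: "A \<in> F \<union> H \<rightarrow> Fpow X"
  shows "f (\<Union>g\<in>F \<union> H - {f}. A g) \<le> (hat X F + hat X H) + (\<Sum>g\<in>F \<union> H - {f}. g (A g))"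
proof -
  define C where "C = (\<Union>g\<in>H - F. A g)"
  have C: "C \<in> Fpow X"
    using A H by (auto simp: C_def Fpow_iff Pi_iff)
  have un: "F \<union> H - {f} = (F - {f}) \<union> (H - F)"
    using f by auto
  have split: "(\<Union>g\<in>F \<union> H - {f}. A g) = (\<Union>g\<in>F - {f}. A g) \<union> C"
    unfolding un C_def by auto
  have sum: "(\<Sum>g\<in>F \<union> H - {f}. g (A g)) = (\<Sum>g\<in>F - {f}. g (A g)) + (\<Sum>g\<in>H - F. g (A g))"
    unfolding un using F H by (intro sum.union_disjoint) auto
  have kC: "k C \<le> hat X H + (\<Sum>g\<in>H - F. g (A g))"
  proof -
    \<comment> \<open>Members of \<open>F \<inter> H\<close> get the empty set here, because their
      sets are counted on the \<open>F\<close> side.\<close>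
    define B where "B g = (if g \<in> F then {} else A g)" for g
    have "k (\<Union>g\<in>H - {k}. B g) - (\<Sum>g\<in>H - {k}. g (B g)) \<le> hat X H"
      using H k A by (intro hat_ge) (auto simp: B_def Fpow_iff Pi_iff)
    moreover have "(\<Union>g\<in>H - {k}. B g) = C"
      using k by (auto simp: B_def C_def split: if_splits)
    moreover have "(\<Sum>g\<in>H - {k}. g (B g)) = (\<Sum>g\<in>H - F. g (A g))"
      using k H E_empty by (intro sum.mono_neutral_cong_right) (auto simp: B_def)
    ultimately show ?thesis
      by simp
  qed
  have R: "(\<Union>g\<in>F - {f}. A g) \<in> Fpow X"
    using A F by (auto simp: Fpow_iff Pi_iff)
  show ?thesis
  \<comment> \<open>If k leads, \<open>C\<close> is split off by subadditivity; otherwise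
    \<open>C\<close> enlarges the set given to k.\<close>
  proof (cases "f = k")
    case True
    have "f ((\<Union>g\<in>F - {f}. A g) \<union> C) \<le> f (\<Union>g\<in>F - {f}. A g) + f C"
      using F f R C by (intro E_subadd) auto
    moreover have "f (\<Union>g\<in>F - {f}. A g) - (\<Sum>g\<in>F - {f}. g (A g)) \<le> hat X F"
      using F f A by (intro hat_ge) auto
    ultimately show ?thesis
      using kC True split sum by simp
  next
    case False
    have kin: "A k \<in> Fpow X"
      using A k by auto
    have "f (\<Union>g\<in>F - {f}. (A(k := A k \<union> C)) g) - (\<Sum>g\<in>F - {f}. g ((A(k := A k \<union> C)) g)) \<le> hat X F"
      using F f A C kin by (intro hat_ge) (auto simp: Fpow_iff Pi_iff)
    moreover have "(\<Union>g\<in>F - {f}. (A(k := A k \<union> C)) g) = (\<Union>g\<in>F - {f}. A g) \<union> C"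
      using k False by (auto split: if_splits)
    moreover have "(\<Sum>g\<in>F - {f}. g ((A(k := A k \<union> C)) g)) = k (A k \<union> C) + (\<Sum>g\<in>F - {f} - {k}. g (A g))"
      using k False F by (subst sum.remove[of _ k]) (auto intro: sum.cong)
    moreover have "(\<Sum>g\<in>F - {f}. g (A g)) = k (A k) + (\<Sum>g\<in>F - {f} - {k}. g (A g))"
      using k False F by (subst sum.remove[of _ k]) auto
    moreover have "k (A k \<union> C) \<le> k (A k) + k C"
      using F k kin C by (intro E_subadd) auto
    ultimately show ?thesis
      using kC split sum by simp
  qed
qed

lemma diversity_hat: "diversity (E X \<delta>) (hat X)"
proof (rule diversityI)
  fix F H k assume "F \<in> Fpow (E X \<delta>)" "H \<in> Fpow (E X \<delta>)" and k: "k \<in> F" "k \<in> H"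
  then have F: "finite F" "F \<subseteq> E X \<delta>" and H: "finite H" "H \<subseteq> E X \<delta>"
    by (auto simp: Fpow_iff)
  show "hat X (F \<union> H) \<le> hat X F + hat X H"
  proof (rule hat_le)
    fix f A assume "f \<in> F \<union> H" "A \<in> F \<union> H \<rightarrow> Fpow X"
    then show "f (\<Union>g\<in>F \<union> H - {f}. A g) \<le> (hat X F + hat X H) + (\<Sum>g\<in>F \<union> H - {f}. g (A g))"
      using hat_join_aux[OF F H k, of f A] hat_join_aux[OF H F k(2,1), of f A]
      by (auto simp: Un_commute add.commute)
  qed (use F H k in auto)
next
  fix f g assume fg: "f \<in> E X \<delta>" "g \<in> E X \<delta>" "f \<noteq> g"
  then obtain A where A: "A \<in> Fpow X" "f A \<noteq> g A"
    using E_eqI by blast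
  have "f A - g A \<le> hat X {f, g}" "g A - f A \<le> hat X {f, g}"
    using hat_ge[of "{f, g}" f "\<lambda>_. A"] hat_ge[of "{f, g}" g "\<lambda>_. A"] fg A
    by (simp_all add: insert_Diff_if)
  then show "0 < hat X {f, g}"
    using A by linarith
qed (auto simp: hat_def[of _ "{}"] hat_def[of _ "{x}" for x] Fpow_iff intro: hat_mono)

text \<open>On two functions \<open>hat\<close> is the supremum distance. This half of that fact
  turns pointwise estimates into closeness in \<open>E\<close>.\<close>

lemma hat_pair_le:
  assumes "f \<in> E X \<delta>" "g \<in> E X \<delta>" "0 \<le> c" "\<And>A. A \<in> Fpow X \<Longrightarrow> \<bar>f A - g A\<bar> \<le> c"
  shows "hat X {f, g} \<le> c"
proof (cases "f = g")
  case False
  show ?thesis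
  proof (rule hat_le)
    fix h A assume "h \<in> {f, g}" and A: "A \<in> {f, g} \<rightarrow> Fpow X"
    then show "h (\<Union>g\<in>{f, g} - {h}. A g) \<le> c + (\<Sum>g\<in>{f, g} - {h}. g (A g))"
      using assms(4)[of "A f"] assms(4)[of "A g"] False
      by (auto simp: insert_Diff_if)
  qed (use assms in auto)
qed (simp add: hat_def \<open>0 \<le> c\<close>)

section \<open>Points of the space as admissible functions\<close>

lemma kappa_apply: "A \<in> Fpow X \<Longrightarrow> kappa X \<delta> x A = \<delta> (insert x A)"
  by (simp add: kappa_def)

lemma kappa_in_E:
  assumes x: "x \<in> X"
  shows "kappa X \<delta> x \<in> E X \<delta>"
proof -
  have un: "A \<union> B \<in> Fpow X" if "A \<in> Fpow X" "B \<in> Fpow X" for A B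
    using that by (auto simp: Fpow_iff)
  have ins: "insert x A \<in> Fpow X" if "A \<in> Fpow X" for A
    using that x by (auto simp: Fpow_iff)
  have "lip_functional X \<delta> (kappa X \<delta> x)"
    unfolding lip_functional_def
  proof (intro ballI impI)
    fix A B C assume *: "A \<in> Fpow X" "B \<in> Fpow X" "C \<in> Fpow X" "C \<noteq> {}"
    then show "kappa X \<delta> x (A \<union> B) \<le> kappa X \<delta> x (A \<union> C) + \<delta> (B \<union> C)"
      using diversity_lip[OF div] ins[of A] unfolding lip_functional_def
      by (metis Un_insert_left kappa_apply un)
  qed
  moreover have "\<delta> A \<le> kappa X \<delta> x A" if "A \<in> Fpow X" for A
    using diversity_mono[OF div ins[OF that]] that by (auto simp: kappa_apply)
  moreover have "kappa X \<delta> x (A \<union> B) \<le> kappa X \<delta> x A + kappa X \<delta> x B"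
    if "A \<in> Fpow X" "B \<in> Fpow X" for A B
    using diversity_join[OF div ins ins, of A B x] that un by (simp add: kappa_apply)
  moreover have "kappa X \<delta> x {} = 0"
    using diversity_single[OF div x] by (simp add: kappa_apply Fpow_iff)
  ultimately show ?thesis
    by (simp add: E_iff[OF div] adm_def) (simp add: kappa_def)
qed

text \<open>Lower bound: give {x} to the function of x, at no cost. Upper bound: the set given to
  the function of x is traded for x, at exactly the cost that the sum charges for it. This identity
  is why f, once it is a point of the next level, has the prescribed values on old points.\<close>

lemma hat_insert_kappa:
  assumes f: "f \<in> E X \<delta>" and A: "A \<in> Fpow X"
  shows "hat X (insert f (kappa X \<delta> ` A)) = f A"
proof (rule antisym)
  let ?k = "kappa X \<delta>"
  have fin: "finite (insert f (?k ` A))" "insert f (?k ` A) \<subseteq> E X \<delta>"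
    using f A kappa_in_E by (auto simp: Fpow_iff)
  have inj: "inj_on ?k A"
    using inj_on_kappa[OF div] A by (auto simp: Fpow_iff intro: inj_on_subset)
  have app: "?k x {x} = 0" "?k x {} = 0" if "x \<in> A" for x
    using that A by (auto simp: kappa_apply Fpow_iff diversity_single[OF div])
  define B where "B g = (if g \<in> ?k ` A then {inv_into A ?k g} else {})" for g
  have B: "B (?k x) = {x}" if "x \<in> A" for x
    using that inj by (simp add: B_def)
  have "f (\<Union>g\<in>insert f (?k ` A) - {f}. B g) - (\<Sum>g\<in>insert f (?k ` A) - {f}. g (B g)) \<le> hat X (insert f (?k ` A))"
    using fin A by (intro hat_ge) (auto simp: Fpow_iff B)
  moreover have "(\<Sum>g\<in>insert f (?k ` A) - {f}. g (B g)) = 0"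
    by (intro sum.neutral) (auto simp: B app)
  moreover have "f (\<Union>g\<in>insert f (?k ` A) - {f}. B g) = f A"
  \<comment> \<open>If f is the function of some x in \<open>A\<close>, the set {x} is missing from
    the union, but then the value of f is the same with or without x.\<close>
  proof (cases "f \<in> ?k ` A")
    case False
    then have "(\<Union>g\<in>insert f (?k ` A) - {f}. B g) = A"
      by (auto simp: B)
    then show ?thesis
      by simp
  next
    case True
    then obtain x where x: "x \<in> A" "f = ?k x"
      by blast
    have "(\<Union>g\<in>insert f (?k ` A) - {f}. B g) = (\<Union>y\<in>A - {x}. B (?k y))"
      using x inj by (auto simp: inj_on_def)
    also have "\<dots> = A - {x}"
      by (auto simp: B)
    finally have "(\<Union>g\<in>insert f (?k ` A) - {f}. B g) = A - {x}" .
    moreover have "A - {x} \<in> Fpow X" "insert x A = A"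
      using x A by (auto simp: Fpow_iff)
    ultimately show ?thesis
      using x A by (simp add: kappa_apply)
  qed
  ultimately show "f A \<le> hat X (insert f (?k ` A))"
    by simp
  show "hat X (insert f (?k ` A)) \<le> f A"
  proof (rule hat_le[OF fin])
    fix h P assume h: "h \<in> insert f (?k ` A)" and P: "P \<in> insert f (?k ` A) \<rightarrow> Fpow X"
    have Pk: "P (?k x) \<in> Fpow X" if "x \<in> A" for x
      using P that by auto
    \<comment> \<open>\<open>R\<close> is empty when f leads; when the function of x leads, it keeps
      x in place.\<close>
    have main: "f (R \<union> (\<Union>g\<in>?k ` I. P g)) \<le> f A + (\<Sum>g\<in>?k ` I. g (P g))"
      if "I \<subseteq> A" "R \<subseteq> A" for I R
    proof -
      have I: "finite I" "I \<subseteq> X" "R \<in> Fpow X" "inj_on ?k I"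
        using that A inj by (auto simp: Fpow_iff finite_subset intro: inj_on_subset)
      have "f (R \<union> (\<Union>i\<in>I. P (?k i))) \<le> f (R \<union> (\<lambda>i. i) ` I) + (\<Sum>i\<in>I. \<delta> (insert i (P (?k i))))"
        using that Pk I by (intro lip_functional_UN[OF E_lip[OF f]]) auto
      also have "f (R \<union> (\<lambda>i. i) ` I) \<le> f A"
        using that A by (intro E_mono[OF f]) auto
      also have "(\<Sum>i\<in>I. \<delta> (insert i (P (?k i)))) = (\<Sum>i\<in>I. ?k i (P (?k i)))"
        using Pk that by (intro sum.cong) (auto simp: kappa_apply)
      finally show ?thesis
        using I by (simp add: sum.reindex)
    qed
    show "h (\<Union>g\<in>insert f (?k ` A) - {h}. P g) \<le> f A + (\<Sum>g\<in>insert f (?k ` A) - {h}. g (P g))"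
    proof (cases "h = f")
      case True
      have eq: "insert f (?k ` A) - {h} = ?k ` {x \<in> A. ?k x \<noteq> f}"
        using True by auto
      show ?thesis
        unfolding eq using main[of "{x \<in> A. ?k x \<noteq> f}" "{}"] True by simp
    next
      case False
      then obtain x where x: "x \<in> A" "h = ?k x"
        using h by blast
      let ?I = "{y \<in> A. ?k y \<noteq> f \<and> ?k y \<noteq> h}"
      have eq: "insert f (?k ` A) - {h} = insert f (?k ` ?I)"
        using False by auto
      let ?Q = "\<Union>g\<in>?k ` ?I. P g"
      have fin2: "?Q \<in> Fpow X" "P f \<in> Fpow X" "x \<in> X"
        using A P x by (auto simp: Fpow_iff Pi_iff)
      have "h (\<Union>g\<in>insert f (?k ` ?I). P g) = \<delta> (insert x (P f \<union> ?Q))"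
        using fin2 x by (simp add: kappa_apply Fpow_iff)
      \<comment> \<open>The inequality \<open>\<delta> \<le> f\<close> brings in f, so that
        subadditivity can split off \<open>f (P f)\<close>, the term charged to f.\<close>
      also have "\<dots> \<le> f (P f \<union> ({x} \<union> ?Q))"
        using fin2 E_ge[OF f, of "insert x (P f \<union> ?Q)"] by (simp add: Fpow_iff)
      also have "\<dots> \<le> f (P f) + f ({x} \<union> ?Q)"
        using fin2 by (intro E_subadd[OF f]) (auto simp: Fpow_iff)
      also have "f ({x} \<union> ?Q) \<le> f A + (\<Sum>g\<in>?k ` ?I. g (P g))"
        using x by (intro main) auto
      also have "f (P f) + (f A + (\<Sum>g\<in>?k ` ?I. g (P g))) = f A + (\<Sum>g\<in>insert f (?k ` ?I). g (P g))"
        using A by (subst sum.insert) (auto simp: Fpow_iff)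
      finally show ?thesis
        unfolding eq by simp
    qed
  qed simp
qed

end

section \<open>Finitely supported functions\<close>

lemma diversity_subset:
  assumes "diversity X \<delta>" "S \<subseteq> X"
  shows "diversity S \<delta>"
proof -
  have "Fpow S \<subseteq> Fpow X"
    using assms(2) by (rule Fpow_mono)
  then show ?thesis
    using assms(1) unfolding diversity_def subset_iff by blast
qed

lemma adm_subset:
  assumes "adm X \<delta> f" "S \<subseteq> X"
  shows "adm S \<delta> f"
proof -
  have "Fpow S \<subseteq> Fpow X"
    using assms(2) by (rule Fpow_mono)
  then show ?thesis
    using assms(1) unfolding adm_def lip_functional_def subset_iff by blast
qed

lemma adm_cong:
  assumes f: "adm X \<delta> f" and eq: "\<And>A. A \<in> Fpow X \<Longrightarrow> f' A = f A"
  shows "adm X \<delta> f'"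
proof -
  have "A \<union> B \<in> Fpow X" if "A \<in> Fpow X" "B \<in> Fpow X" for A B
    using that by (auto simp: Fpow_iff)
  then show ?thesis
    using f eq by (simp add: adm_def lip_functional_def Fpow_iff)
qed

lemma restrict_in_E:
  assumes "diversity S \<delta>" "adm S \<delta> f"
  shows "restrict f (Fpow S) \<in> E S \<delta>"
  using assms by (auto simp: E_iff intro: adm_cong)

lemma support_extension_cong:
  assumes "\<And>B. B \<in> Fpow S \<Longrightarrow> f B = f' B"
  shows "support_extension X \<delta> S f = support_extension X \<delta> S f'"
proof -
  have "{f B + (\<Sum>b\<in>B. \<delta> (insert b (P b))) |B P. B \<in> Fpow S \<and> (\<Union>b\<in>B. P b) = A} =
      {f' B + (\<Sum>b\<in>B. \<delta> (insert b (P b))) |B P. B \<in> Fpow S \<and> (\<Union>b\<in>B. P b) = A}" for A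
    using assms by (intro Collect_cong) (metis (no_types, lifting))
  then show ?thesis
    by (simp add: support_extension_def)
qed

context
  fixes X :: "'a set" and \<delta> :: "'a set \<Rightarrow> real" and S :: "'a set"
  assumes div: "diversity X \<delta>" and S: "S \<subseteq> X" "S \<noteq> {}"
begin

lemma support_extension_ge:
  assumes A: "A \<in> Fpow X"
    and le: "\<And>B P. B \<in> Fpow S \<Longrightarrow> (\<And>b. b \<in> B \<Longrightarrow> P b \<in> Fpow X) \<Longrightarrow> (\<Union>b\<in>B. P b) = A \<Longrightarrow>
      c \<le> f B + (\<Sum>b\<in>B. \<delta> (insert b (P b)))"
  shows "c \<le> support_extension X \<delta> S f A"
proof -
  obtain s where s: "s \<in> S"
    using S by blast
  \<comment> \<open>A single centre s with all of \<open>A\<close> as its piece: this makes the set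
    nonempty, as \<open>Inf\<close> requires.\<close>
  have "f {s} + (\<Sum>b\<in>{s}. \<delta> (insert b A))
      \<in> {f B + (\<Sum>b\<in>B. \<delta> (insert b (P b))) |B P. B \<in> Fpow S \<and> (\<Union>b\<in>B. P b) = A}"
    using s by (intro CollectI exI[of _ "{s}"] exI[of _ "\<lambda>_. A"]) (auto simp: Fpow_iff)
  moreover have "P b \<in> Fpow X" if "(\<Union>b\<in>B. P b) = A" "b \<in> B" for P b and B :: "'a set"
    using that A by (auto simp: Fpow_iff intro: finite_subset)
  ultimately show ?thesis
    using A unfolding support_extension_def
    by (simp del: sum.insert) (intro cInf_greatest, auto intro!: le)
qed

lemma support_extension_le:
  assumes f: "adm S \<delta> f" and A: "A \<in> Fpow X" and B: "B \<in> Fpow S" and P: "(\<Union>b\<in>B. P b) = A"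
  shows "support_extension X \<delta> S f A \<le> f B + (\<Sum>b\<in>B. \<delta> (insert b (P b)))"
proof -
  have "0 \<le> f C + (\<Sum>b\<in>C. \<delta> (insert b (Q b)))" if "C \<in> Fpow S" "(\<Union>b\<in>C. Q b) = A" for C Q
  proof -
    have "insert b (Q b) \<in> Fpow X" if "b \<in> C" for b
    proof -
      have "Q b \<subseteq> A"
        using that \<open>(\<Union>b\<in>C. Q b) = A\<close> by blast
      then show ?thesis
        using A S that \<open>C \<in> Fpow S\<close> by (auto simp: Fpow_iff intro: finite_subset)
    qed
    then show ?thesis
      using that adm_nonneg[OF diversity_subset[OF div S(1)] f]
      by (intro add_nonneg_nonneg sum_nonneg diversity_nonneg[OF div]) auto
  qed
  then have "bdd_below {f B + (\<Sum>b\<in>B. \<delta> (insert b (P b))) |B P. B \<in> Fpow S \<and> (\<Union>b\<in>B. P b) = A}"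
    by (intro bdd_belowI[of _ 0]) auto
  then show ?thesis
    unfolding support_extension_def using A B P
    by (auto intro!: cInf_lower)
qed

lemma support_extension_diff:
  assumes f: "adm S \<delta> f" and g: "adm S \<delta> g"
    and le: "\<And>B. B \<in> Fpow S \<Longrightarrow> f B \<le> g B + e" and A: "A \<in> Fpow X"
  shows "support_extension X \<delta> S f A \<le> support_extension X \<delta> S g A + e"
proof -
  have "support_extension X \<delta> S f A - e \<le> support_extension X \<delta> S g A"
  proof (rule support_extension_ge[OF A])
    fix B P assume "B \<in> Fpow S" "(\<Union>b\<in>B. P b) = A"
    then show "support_extension X \<delta> S f A - e \<le> g B + (\<Sum>b\<in>B. \<delta> (insert b (P b)))"
      using support_extension_le[OF f A, of B P] le[of B] by simp
  qed
  then show ?thesis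
    by simp
qed

text \<open>By \<open>lip_functional_UN\<close> every cover costs at least \<open>g A\<close>. Hence
  the extension is the largest admissible function with given values on \<open>S\<close>.\<close>

lemma support_extension_lower:
  assumes g: "adm X \<delta> g" and A: "A \<in> Fpow X"
  shows "g A \<le> support_extension X \<delta> S g A"
proof (rule support_extension_ge[OF A])
  fix B P assume B: "B \<in> Fpow S" and P: "\<And>b. b \<in> B \<Longrightarrow> P b \<in> Fpow X" "(\<Union>b\<in>B. P b) = A"
  show "g A \<le> g B + (\<Sum>b\<in>B. \<delta> (insert b (P b)))"
    using lip_functional_UN[OF adm_lip[OF g], of B "{}" P "\<lambda>b. b"] B P S
    by (auto simp: Fpow_iff)
qed

text \<open>Covering \<open>A\<close> by its own singletons adds no cost to \<open>f A\<close>, and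
  no cover is cheaper: all pieces lie in \<open>S\<close>, where f is Lipschitz.\<close>

lemma support_extension_eq:
  assumes f: "adm S \<delta> f" and A: "A \<in> Fpow S"
  shows "support_extension X \<delta> S f A = f A"
proof (rule antisym)
  have AX: "A \<in> Fpow X"
    using A S by (auto simp: Fpow_iff)
  have "(\<Sum>b\<in>A. \<delta> (insert b {b})) = 0"
    using AX by (intro sum.neutral) (auto simp: Fpow_iff diversity_single[OF div])
  then show "support_extension X \<delta> S f A \<le> f A"
    using support_extension_le[OF f AX A, of "\<lambda>b. {b}"] by simp
  show "f A \<le> support_extension X \<delta> S f A"
  proof (rule support_extension_ge[OF AX])
    fix B P assume B: "B \<in> Fpow S" and P: "\<And>b. b \<in> B \<Longrightarrow> P b \<in> Fpow X" "(\<Union>b\<in>B. P b) = A"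
    have "P b \<in> Fpow S" if "b \<in> B" for b
      using P A that by (auto simp: Fpow_iff)
    then show "f A \<le> f B + (\<Sum>b\<in>B. \<delta> (insert b (P b)))"
      using lip_functional_UN[OF adm_lip[OF f], of B "{}" P "\<lambda>b. b"] B P(2)
      by (auto simp: Fpow_iff)
  qed
qed

text \<open>Each inequality is checked on covers and passed to the infimum. For monotonicity the
  pieces are cut down to the smaller set; for subadditivity two covers are merged; for the Lipschitz
  condition a piece that meets \<open>C\<close> takes up the new set.\<close>

lemma adm_support_extension:
  assumes f: "adm S \<delta> f"
  shows "adm X \<delta> (support_extension X \<delta> S f)"
proof -
  let ?g = "support_extension X \<delta> S f"
  note divS = diversity_subset[OF div S(1)]
  have "?g {} = 0"
    using support_extension_eq[OF f, of "{}"] adm_empty[OF f] by (simp add: Fpow_iff)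
  moreover have "\<delta> A \<le> ?g A" if A: "A \<in> Fpow X" for A
  proof (rule support_extension_ge[OF A])
    fix B P assume B: "B \<in> Fpow S" and P: "\<And>b. b \<in> B \<Longrightarrow> P b \<in> Fpow X" "(\<Union>b\<in>B. P b) = A"
    have "\<delta> A \<le> \<delta> B + (\<Sum>b\<in>B. \<delta> (insert b (P b)))"
      using lip_functional_UN[OF diversity_lip[OF div], of B "{}" P "\<lambda>b. b"] B P S
      by (auto simp: Fpow_iff)
    then show "\<delta> A \<le> f B + (\<Sum>b\<in>B. \<delta> (insert b (P b)))"
      using adm_ge[OF f B] by simp
  qed
  moreover have mono: "?g A \<le> ?g A'" if A': "A' \<in> Fpow X" and AA: "A \<subseteq> A'" for A A'
  proof (rule support_extension_ge[OF A'])
    fix B P assume B: "B \<in> Fpow S" and P: "\<And>b. b \<in> B \<Longrightarrow> P b \<in> Fpow X" "(\<Union>b\<in>B. P b) = A'"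
    have "?g A \<le> f B + (\<Sum>b\<in>B. \<delta> (insert b (P b \<inter> A)))"
      using A' AA P(2) by (intro support_extension_le[OF f _ B]) (auto simp: Fpow_iff finite_subset)
    also have "(\<Sum>b\<in>B. \<delta> (insert b (P b \<inter> A))) \<le> (\<Sum>b\<in>B. \<delta> (insert b (P b)))"
      using P B S by (intro sum_mono diversity_mono[OF div]) (auto simp: Fpow_iff)
    finally show "?g A \<le> f B + (\<Sum>b\<in>B. \<delta> (insert b (P b)))"
      by simp
  qed
  moreover have "?g (A \<union> A') \<le> ?g A + ?g A'" if A: "A \<in> Fpow X" and A': "A' \<in> Fpow X" for A A'
  proof -
    have AA: "A \<union> A' \<in> Fpow X"
      using A A' by (auto simp: Fpow_iff)
    have "?g (A \<union> A') - ?g A' \<le> ?g A"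
    proof (rule support_extension_ge[OF A])
      fix B P assume B: "B \<in> Fpow S" and P: "\<And>b. b \<in> B \<Longrightarrow> P b \<in> Fpow X" "(\<Union>b\<in>B. P b) = A"
      have "?g (A \<union> A') - (f B + (\<Sum>b\<in>B. \<delta> (insert b (P b)))) \<le> ?g A'"
      proof (rule support_extension_ge[OF A'])
        fix C Q assume C: "C \<in> Fpow S" and Q: "\<And>b. b \<in> C \<Longrightarrow> Q b \<in> Fpow X" "(\<Union>b\<in>C. Q b) = A'"
        \<comment> \<open>Padding by \<open>{}\<close> lets both sums run over
          \<open>B \<union> C\<close>; a padded term is \<open>\<delta> {b} = 0\<close>.\<close>
        define P' where "P' b = (if b \<in> B then P b else {})" for b
        define Q' where "Q' b = (if b \<in> C then Q b else {})" for b
        have BC: "B \<union> C \<in> Fpow S"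
          using B C by (auto simp: Fpow_iff)
        have in_X: "insert b (P' b) \<in> Fpow X" "insert b (Q' b) \<in> Fpow X" if "b \<in> B \<union> C" for b
          using that P(1)[of b] Q(1)[of b] B C S by (auto simp: P'_def Q'_def Fpow_iff)
        have "?g (A \<union> A') \<le> f (B \<union> C) + (\<Sum>b\<in>B \<union> C. \<delta> (insert b (P' b \<union> Q' b)))"
          using P(2) Q(2) by (intro support_extension_le[OF f AA BC]) (auto simp: P'_def Q'_def split: if_splits)
        also have "(\<Sum>b\<in>B \<union> C. \<delta> (insert b (P' b \<union> Q' b))) \<le>
            (\<Sum>b\<in>B \<union> C. \<delta> (insert b (P' b)) + \<delta> (insert b (Q' b)))"
        proof (rule sum_mono)
          fix b assume b: "b \<in> B \<union> C"
          show "\<delta> (insert b (P' b \<union> Q' b)) \<le> \<delta> (insert b (P' b)) + \<delta> (insert b (Q' b))"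
            using diversity_join[OF div in_X[OF b], of b] by simp
        qed
        also have "\<dots> = (\<Sum>b\<in>B. \<delta> (insert b (P b))) + (\<Sum>b\<in>C. \<delta> (insert b (Q b)))"
        proof -
          have "(\<Sum>b\<in>B \<union> C. \<delta> (insert b (P' b))) = (\<Sum>b\<in>B. \<delta> (insert b (P b)))"
            using B C S by (intro sum.mono_neutral_cong_right)
              (auto simp: P'_def Fpow_iff diversity_single[OF div])
          moreover have "(\<Sum>b\<in>B \<union> C. \<delta> (insert b (Q' b))) = (\<Sum>b\<in>C. \<delta> (insert b (Q b)))"
            using B C S by (intro sum.mono_neutral_cong_right)
              (auto simp: Q'_def Fpow_iff diversity_single[OF div])
          ultimately show ?thesis
            by (simp add: sum.distrib)
        qed
        finally show "?g (A \<union> A') - (f B + (\<Sum>b\<in>B. \<delta> (insert b (P b)))) \<le>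
            f C + (\<Sum>b\<in>C. \<delta> (insert b (Q b)))"
          using adm_subadd[OF f B C] by simp
      qed
      then show "?g (A \<union> A') - ?g A' \<le> f B + (\<Sum>b\<in>B. \<delta> (insert b (P b)))"
        by simp
    qed
    then show ?thesis
      by simp
  qed
  moreover have "lip_functional X \<delta> ?g"
    unfolding lip_functional_def
  proof (intro ballI impI)
    fix A D C assume A: "A \<in> Fpow X" and D: "D \<in> Fpow X" and C: "C \<in> Fpow X" "C \<noteq> {}"
    have in_X: "A \<union> C \<in> Fpow X" "A \<union> C \<union> D \<in> Fpow X" "D \<union> C \<in> Fpow X"
      using A D C by (auto simp: Fpow_iff)
    \<comment> \<open>The pieces of a cover must have exactly the given set as their union, so
      \<open>C\<close> is kept here and dropped afterwards by monotonicity.\<close>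
    have "?g (A \<union> C \<union> D) - \<delta> (D \<union> C) \<le> ?g (A \<union> C)"
    proof (rule support_extension_ge[OF in_X(1)])
      fix B P assume B: "B \<in> Fpow S" and P: "\<And>b. b \<in> B \<Longrightarrow> P b \<in> Fpow X" "(\<Union>b\<in>B. P b) = A \<union> C"
      obtain c b where c: "c \<in> C" and b: "b \<in> B" "c \<in> P b"
        using C P(2) by blast
      have fin: "finite B"
        using B by (auto simp: Fpow_iff)
      have in_X': "insert b (P b) \<in> Fpow X" "insert c D \<in> Fpow X"
        using b c P(1)[OF b(1)] B C D S by (auto simp: Fpow_iff)
      have "?g (A \<union> C \<union> D) \<le> f B + (\<Sum>x\<in>B. \<delta> (insert x ((P(b := P b \<union> D)) x)))"
        using P(2) b by (intro support_extension_le[OF f in_X(2) B]) (auto split: if_splits)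
      also have "(\<Sum>x\<in>B. \<delta> (insert x ((P(b := P b \<union> D)) x))) =
          \<delta> (insert b (P b \<union> D)) + (\<Sum>x\<in>B - {b}. \<delta> (insert x (P x)))"
        using b fin by (subst sum.remove[of _ b]) (auto intro!: sum.cong)
      also have "\<delta> (insert b (P b \<union> D)) \<le> \<delta> (insert b (P b)) + \<delta> (insert c D)"
        using diversity_join[OF div in_X', of c] b by (simp add: insert_absorb)
      also have "\<delta> (insert c D) \<le> \<delta> (D \<union> C)"
        using c by (intro diversity_mono[OF div in_X(3)]) auto
      also have "\<delta> (insert b (P b)) + \<delta> (D \<union> C) + (\<Sum>x\<in>B - {b}. \<delta> (insert x (P x))) =
          (\<Sum>x\<in>B. \<delta> (insert x (P x))) + \<delta> (D \<union> C)"
        using b fin by (subst sum.remove[of _ b]) auto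
      finally show "?g (A \<union> C \<union> D) - \<delta> (D \<union> C) \<le> f B + (\<Sum>x\<in>B. \<delta> (insert x (P x)))"
        by simp
    qed
    moreover have "?g (A \<union> D) \<le> ?g (A \<union> C \<union> D)"
      by (intro mono in_X) auto
    ultimately show "?g (A \<union> D) \<le> ?g (A \<union> C) + \<delta> (D \<union> C)"
      by simp
  qed
  ultimately show ?thesis
    unfolding adm_def by blast
qed

lemma support_extension_in_E_omega:
  assumes "finite S" and f: "adm S \<delta> f"
  shows "support_extension X \<delta> S f \<in> E_omega X \<delta>"
proof -
  have "support_extension X \<delta> S f = support_extension X \<delta> S (restrict f (Fpow S))"
    by (intro support_extension_cong) simp
  moreover have "support_extension X \<delta> S f \<in> E X \<delta>"
    using adm_support_extension[OF f] by (simp add: E_iff[OF div]) (simp add: support_extension_def)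
  ultimately show ?thesis
    using assms S restrict_in_E[OF diversity_subset[OF div S(1)] f] unfolding E_omega_def by blast
qed

end

context
  fixes X :: "'a set" and \<delta> :: "'a set \<Rightarrow> real"
  assumes div: "diversity X \<delta>"
begin

text \<open>The support is {x}: the cover of \<open>A\<close> with the single centre x already
  attains the value, and \<open>support_extension_lower\<close> gives the other bound.\<close>

lemma kappa_in_E_omega:
  assumes x: "x \<in> X"
  shows "kappa X \<delta> x \<in> E_omega X \<delta>"
proof -
  have x': "{x} \<subseteq> X" "{x} \<noteq> {}" "X \<noteq> {}"
    using x by auto
  have k: "adm X \<delta> (kappa X \<delta> x)"
    using kappa_in_E[OF div x'(3) x] E_iff[OF div] by blast
  have k': "adm {x} \<delta> (kappa X \<delta> x)"
    by (rule adm_subset[OF k x'(1)])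
  have "kappa X \<delta> x = support_extension X \<delta> {x} (kappa X \<delta> x)"
  proof (rule extensionalityI[of _ "Fpow X"])
    fix A assume A: "A \<in> Fpow X"
    have "support_extension X \<delta> {x} (kappa X \<delta> x) A \<le> kappa X \<delta> x {x} + (\<Sum>b\<in>{x}. \<delta> (insert b A))"
      using A by (intro support_extension_le[OF div x'(1,2) k' A]) (auto simp: Fpow_iff)
    also have "\<dots> = kappa X \<delta> x A"
      using A x diversity_single[OF div x] by (simp add: kappa_def Fpow_iff)
    finally show "kappa X \<delta> x A = support_extension X \<delta> {x} (kappa X \<delta> x) A"
      using support_extension_lower[OF div x'(1,2) k A] by simp
  qed (simp_all add: kappa_def support_extension_def)
  then show ?thesis
    using support_extension_in_E_omega[OF div x'(1,2) _ k'] by simp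
qed

text \<open>Each point x of the support is moved to a nearby \<open>t x\<close> in \<open>D\<close>.
  The value of g on the centres grows by at most their total displacement, and so does the cost of
  the pieces when b is replaced by \<open>t b\<close>. The support has n points, each moved by less
  than \<open>e / (2 * n)\<close>, so both changes together stay within e. In the other direction,
  \<open>support_extension_lower\<close> gives an inequality without error.\<close>

lemma support_extension_approx:
  assumes g: "g \<in> E_omega X \<delta>" and D: "D \<subseteq> X" "\<And>x e. x \<in> X \<Longrightarrow> e > 0 \<Longrightarrow> \<exists>y\<in>D. \<delta> {x, y} < e"
    and e: "e > (0::real)"
  obtains T where "finite T" "T \<subseteq> D" "T \<noteq> {}"
    "\<And>A. A \<in> Fpow X \<Longrightarrow> \<bar>support_extension X \<delta> T g A - g A\<bar> \<le> e"
proof -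
  obtain S f where S: "finite S" "S \<noteq> {}" "S \<subseteq> X" and f: "f \<in> E S \<delta>" and gf: "g = support_extension X \<delta> S f"
    using g by (auto simp: E_omega_def)
  have gadm: "adm X \<delta> g"
    using g by (auto simp: E_omega_def E_iff[OF div])
  have fadm: "adm S \<delta> f"
    using f E_iff[OF diversity_subset[OF div S(3)]] by blast
  have fg: "f B = g B" if "B \<in> Fpow S" for B
    using support_extension_eq[OF div S(3,2) fadm that] gf by simp
  define n where "n = real (card S)"
  have n: "n > 0"
    using S by (simp add: n_def card_gt_0_iff)
  have "\<exists>y\<in>D. \<delta> {x, y} < e / (2 * n)" if "x \<in> S" for x
    using that S e n by (intro D(2)) auto
  then obtain t where t: "\<And>x. x \<in> S \<Longrightarrow> t x \<in> D" "\<And>x. x \<in> S \<Longrightarrow> \<delta> {x, t x} < e / (2 * n)"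
    by metis
  let ?T = "t ` S"
  have T: "finite ?T" "?T \<subseteq> D" "?T \<noteq> {}" "?T \<subseteq> X"
    using S t D by auto
  have Tadm: "adm ?T \<delta> g"
    by (rule adm_subset[OF gadm T(4)])
  show thesis
  proof (rule that[OF T(1-3)])
    fix A assume A: "A \<in> Fpow X"
    have "support_extension X \<delta> ?T g A - e \<le> support_extension X \<delta> S f A"
    proof (rule support_extension_ge[OF div S(3,2) A])
      fix B P assume B: "B \<in> Fpow S" and P: "\<And>b. b \<in> B \<Longrightarrow> P b \<in> Fpow X" "(\<Union>b\<in>B. P b) = A"
      have B': "finite B" "B \<subseteq> S" "B \<subseteq> X"
        using B S by (auto simp: Fpow_iff)
      then have tB: "t ` B \<subseteq> X"
        using T(4) by (metis image_mono subset_trans)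
      \<comment> \<open>Since \<open>t\<close> need not be injective, the pieces whose centres land
        on the same c are merged; adding c to each of them gives a common point, which makes
        \<open>\<delta>\<close> subadditive on them.\<close>
      define I where "I c = {b \<in> B. t b = c}" for c
      have near: "(\<Sum>b\<in>B. \<delta> {b, t b}) \<le> e / 2"
      proof -
        have "(\<Sum>b\<in>B. \<delta> {b, t b}) \<le> real (card B) * (e / (2 * n))"
          using B' t(2) by (intro sum_bounded_above) (auto intro: less_imp_le)
        also have "\<dots> \<le> n * (e / (2 * n))"
          using B' S e n by (intro mult_right_mono) (auto simp: n_def card_mono)
        finally show ?thesis
          using n by simp
      qed
      have moved: "g (t ` B) \<le> g B + (\<Sum>b\<in>B. \<delta> {b, t b})"
        using lip_functional_UN[OF adm_lip[OF gadm], of B "{}" "\<lambda>b. {t b}" "\<lambda>b. b"] B' tB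
        by (auto simp: Fpow_iff UNION_singleton_eq_range image_subset_iff)
      have "(\<Sum>c\<in>t ` B. \<delta> (insert c (\<Union>b\<in>I c. P b))) \<le> (\<Sum>c\<in>t ` B. \<Sum>b\<in>I c. \<delta> (insert (t b) (P b)))"
      proof (rule sum_mono)
        fix c assume c: "c \<in> t ` B"
        then have I: "finite (I c)" "I c \<noteq> {}" "c \<in> X" "I c \<subseteq> B"
          using B' tB by (auto simp: I_def)
        have "\<delta> ({} \<union> (\<Union>b\<in>I c. insert c (P b))) \<le>
            \<delta> ({} \<union> (\<lambda>_. c) ` I c) + (\<Sum>b\<in>I c. \<delta> (insert c (insert c (P b))))"
          using I P(1) by (intro lip_functional_UN[OF diversity_lip[OF div]]) (auto simp: Fpow_iff subset_iff)
        moreover have "(\<Union>b\<in>I c. insert c (P b)) = insert c (\<Union>b\<in>I c. P b)" "(\<lambda>_. c) ` I c = {c}"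
          using I by auto
        moreover have "(\<Sum>b\<in>I c. \<delta> (insert c (P b))) = (\<Sum>b\<in>I c. \<delta> (insert (t b) (P b)))"
          by (intro sum.cong) (auto simp: I_def)
        ultimately show "\<delta> (insert c (\<Union>b\<in>I c. P b)) \<le> (\<Sum>b\<in>I c. \<delta> (insert (t b) (P b)))"
          using diversity_single[OF div I(3)] by simp
      qed
      also have "\<dots> = (\<Sum>b\<in>B. \<delta> (insert (t b) (P b)))"
        unfolding I_def by (rule sum.image_gen[symmetric, OF B'(1)])
      also have "\<dots> \<le> (\<Sum>b\<in>B. \<delta> (insert b (P b)) + \<delta> {b, t b})"
      proof (rule sum_mono)
        fix b assume b: "b \<in> B"
        have in_X: "insert b (P b) \<in> Fpow X" "{b, t b} \<in> Fpow X"
          using b B' tB P(1)[OF b] by (auto simp: Fpow_iff)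
        have "\<delta> (insert (t b) (P b)) \<le> \<delta> (insert b (P b) \<union> {b, t b})"
          using in_X by (intro diversity_mono[OF div]) (auto simp: Fpow_iff)
        also have "\<dots> \<le> \<delta> (insert b (P b)) + \<delta> {b, t b}"
          by (rule diversity_join[OF div in_X, of b]) auto
        finally show "\<delta> (insert (t b) (P b)) \<le> \<delta> (insert b (P b)) + \<delta> {b, t b}" .
      qed
      finally have sums: "(\<Sum>c\<in>t ` B. \<delta> (insert c (\<Union>b\<in>I c. P b))) \<le>
          (\<Sum>b\<in>B. \<delta> (insert b (P b))) + (\<Sum>b\<in>B. \<delta> {b, t b})"
        by (simp add: sum.distrib)
      have "support_extension X \<delta> ?T g A \<le> g (t ` B) + (\<Sum>c\<in>t ` B. \<delta> (insert c (\<Union>b\<in>I c. P b)))"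
        using B' P(2) by (intro support_extension_le[OF div T(4,3) Tadm A]) (auto simp: Fpow_iff I_def)
      then show "support_extension X \<delta> ?T g A - e \<le> f B + (\<Sum>b\<in>B. \<delta> (insert b (P b)))"
        using sums moved near fg[OF B] by simp
    qed
    moreover have "g A \<le> support_extension X \<delta> ?T g A"
      by (rule support_extension_lower[OF div T(4,3) gadm A])
    ultimately show "\<bar>support_extension X \<delta> ?T g A - g A\<bar> \<le> e"
      using gf by simp
  qed
qed

end

section \<open>Separability\<close>

definition sep :: "'a set \<Rightarrow> ('a set \<Rightarrow> real) \<Rightarrow> bool" where
  "sep X \<delta> \<longleftrightarrow> (\<exists>D. countable D \<and> D \<subseteq> X \<and> (\<forall>x\<in>X. \<forall>e>0. \<exists>y\<in>D. \<delta> {x, y} < e))"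

text \<open>One representative of each code at each scale \<open>1 / (n + 1)\<close> forms a
  countable dense set. Codes avoid writing down a dense set of admissible functions: rounding the
  values of such a function may destroy admissibility.\<close>

lemma sep_codeI:
  assumes code: "\<And>e. e > 0 \<Longrightarrow> \<exists>c :: 'a \<Rightarrow> 'c. countable (c ` X) \<and> (\<forall>x\<in>X. \<forall>y\<in>X. c x = c y \<longrightarrow> \<delta> {x, y} \<le> e)"
  shows "sep X \<delta>"
proof -
  have "\<exists>c :: 'a \<Rightarrow> 'c. countable (c ` X) \<and> (\<forall>x\<in>X. \<forall>y\<in>X. c x = c y \<longrightarrow> \<delta> {x, y} \<le> 1 / real (Suc n))" for n
    by (rule code) simp
  then obtain c :: "nat \<Rightarrow> 'a \<Rightarrow> 'c" where c: "\<And>n. countable (c n ` X)"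
      "\<And>n x y. x \<in> X \<Longrightarrow> y \<in> X \<Longrightarrow> c n x = c n y \<Longrightarrow> \<delta> {x, y} \<le> 1 / real (Suc n)"
    by metis
  define D where "D = (\<Union>n. inv_into X (c n) ` c n ` X)"
  have "\<exists>y\<in>D. \<delta> {x, y} < e" if x: "x \<in> X" and e: "e > 0" for x e
  proof -
    obtain n where n: "1 / real (Suc n) < e"
      using nat_approx_posE[OF e] by blast
    let ?y = "inv_into X (c n) (c n x)"
    have "?y \<in> D"
      using x by (auto simp: D_def)
    moreover have "\<delta> {x, ?y} \<le> 1 / real (Suc n)"
      using x by (intro c(2)) (auto simp: inv_into_into f_inv_into_f)
    ultimately show ?thesis
      using n by (meson le_less_trans)
  qed
  moreover have "countable D" "D \<subseteq> X"
    using c(1) by (auto simp: D_def inv_into_into)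
  ultimately show ?thesis
    unfolding sep_def by blast
qed

lemma sep_E_omega:
  assumes div: "diversity X \<delta>" and nonempty: "X \<noteq> {}" and sep: "sep X \<delta>"
  shows "sep (E_omega X \<delta>) (hat X)"
proof (rule sep_codeI[where 'c = "'a set \<times> ('a set \<Rightarrow> int)"])
  fix e :: real assume "e > 0"
  then have e: "e / 3 > 0"
    by simp
  obtain D where D: "countable D" "D \<subseteq> X" "\<And>x e. x \<in> X \<Longrightarrow> e > 0 \<Longrightarrow> \<exists>y\<in>D. \<delta> {x, y} < e"
    using sep unfolding sep_def by blast
  have "\<exists>T. finite T \<and> T \<subseteq> D \<and> T \<noteq> {} \<and> (\<forall>A\<in>Fpow X. \<bar>support_extension X \<delta> T g A - g A\<bar> \<le> e / 3)"
    if "g \<in> E_omega X \<delta>" for g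
    using support_extension_approx[OF div that D(2,3) e] by metis
  then obtain T where T: "\<And>g. g \<in> E_omega X \<delta> \<Longrightarrow> finite (T g)" "\<And>g. g \<in> E_omega X \<delta> \<Longrightarrow> T g \<subseteq> D"
      "\<And>g. g \<in> E_omega X \<delta> \<Longrightarrow> T g \<noteq> {}"
      "\<And>g A. g \<in> E_omega X \<delta> \<Longrightarrow> A \<in> Fpow X \<Longrightarrow> \<bar>support_extension X \<delta> (T g) g A - g A\<bar> \<le> e / 3"
    by metis
  \<comment> \<open>The error splits into three parts of \<open>e / 3\<close>: moving the support of
    g, moving that of h, and rounding values on subsets of the common support. A finite subset of
    the countable \<open>D\<close> with finitely many integers leaves countably many codes, and
    \<open>support_extension_diff\<close> spreads the rounding error from the support to the whole
    space.\<close>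
  define c where "c g = (T g, restrict (\<lambda>A. \<lfloor>g A / (e / 3)\<rfloor>) (Fpow (T g)))" for g
  have "countable (c ` E_omega X \<delta>)"
  proof (rule countable_subset)
    show "c ` E_omega X \<delta> \<subseteq> (SIGMA T : Fpow D. Fpow T \<rightarrow>\<^sub>E UNIV)"
      using T by (auto simp: c_def Fpow_iff)
    show "countable (SIGMA T : Fpow D. Fpow T \<rightarrow>\<^sub>E (UNIV :: int set))"
      using D(1) by (intro countable_SIGMA countable_PiE)
        (auto simp: Fpow_def countable_Collect_finite_subset conj_commute)
  qed
  moreover have "hat X {g, h} \<le> e" if g: "g \<in> E_omega X \<delta>" and h: "h \<in> E_omega X \<delta>" and eq: "c g = c h" for g h
  proof -
    have gh: "g \<in> E X \<delta>" "h \<in> E X \<delta>"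
      using g h by (auto simp: E_omega_def)
    have adm: "adm (T g) \<delta> g" "adm (T g) \<delta> h"
      using T(2)[OF g] D(2) gh by (auto simp: E_iff[OF div] intro: adm_subset)
    have Tgh: "T h = T g"
      using eq by (simp add: c_def)
    have B: "g B \<le> h B + e / 3" "h B \<le> g B + e / 3" if "B \<in> Fpow (T g)" for B
    proof -
      have "\<lfloor>g B / (e / 3)\<rfloor> = \<lfloor>h B / (e / 3)\<rfloor>"
      proof -
        have "snd (c g) B = snd (c h) B"
          using eq by simp
        then show ?thesis
          using that by (simp add: c_def Tgh)
      qed
      then have "g B / (e / 3) \<le> h B / (e / 3) + 1" "h B / (e / 3) \<le> g B / (e / 3) + 1"
        by linarith+
      then show "g B \<le> h B + e / 3" "h B \<le> g B + e / 3"
        using e by (simp_all add: field_simps)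
    qed
    have Tg: "T g \<subseteq> X" "T g \<noteq> {}"
      using T(2,3)[OF g] D(2) by auto
    show ?thesis
    proof (rule hat_pair_le[OF div nonempty gh])
      fix A assume A: "A \<in> Fpow X"
      show "\<bar>g A - h A\<bar> \<le> e"
        using T(4)[OF g A] T(4)[OF h A] support_extension_diff[OF div Tg adm B(1) A]
          support_extension_diff[OF div Tg adm(2,1) B(2) A]
        unfolding Tgh by linarith
    qed (use \<open>e > 0\<close> in simp)
  qed
  ultimately show "\<exists>c :: _ \<Rightarrow> 'a set \<times> ('a set \<Rightarrow> int). countable (c ` E_omega X \<delta>) \<and>
      (\<forall>g\<in>E_omega X \<delta>. \<forall>h\<in>E_omega X \<delta>. c g = c h \<longrightarrow> hat X {g, h} \<le> e)"
    by blast
qed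

section \<open>The tower\<close>

lemma Fpow_Un: "A \<in> Fpow X \<Longrightarrow> B \<in> Fpow X \<Longrightarrow> A \<union> B \<in> Fpow X"
  by (auto simp: Fpow_iff)

section \<open>Transport along isomorphisms\<close>

lemma diversity_iso_diversity:
  assumes X: "diversity X \<delta>" and iso: "diversity_iso X \<delta> Y \<rho> \<phi>"
  shows "diversity Y \<rho>"
proof -
  have bij: "bij_betw \<phi> X Y" and eq: "\<And>A. A \<in> Fpow X \<Longrightarrow> \<rho> (\<phi> ` A) = \<delta> A"
    using iso by (auto simp: diversity_iso_def)
  have surj: "\<exists>A'\<in>Fpow X. A = \<phi> ` A'" if "A \<in> Fpow Y" for A
    using that bij finite_subset_image[of A \<phi> X] by (auto simp: Fpow_iff bij_betw_def)
  have card: "card (\<phi> ` A) = card A" if "A \<in> Fpow X" for A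
    using that bij by (auto simp: Fpow_iff bij_betw_def intro: card_image inj_on_subset)
  show ?thesis
    unfolding diversity_def
  proof (intro conjI ballI impI)
    fix A assume "A \<in> Fpow Y"
    then show "0 \<le> \<rho> A" "\<rho> A = 0 \<longleftrightarrow> card A \<le> 1"
      using surj diversity_nonneg[OF X] diversity_zero[OF X] eq card by metis+
  next
    fix A B C assume "A \<in> Fpow Y" "B \<in> Fpow Y" "C \<in> Fpow Y" "B \<noteq> {}"
    then obtain A' B' C' where *: "A' \<in> Fpow X" "B' \<in> Fpow X" "C' \<in> Fpow X" "B' \<noteq> {}"
      "A = \<phi> ` A'" "B = \<phi> ` B'" "C = \<phi> ` C'"
      using surj by (metis image_is_empty)
    then show "\<rho> (A \<union> C) \<le> \<rho> (A \<union> B) + \<rho> (B \<union> C)"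
      using X by (simp add: image_Un[symmetric] eq Fpow_Un diversity_def)
  qed
qed

lemma diversity_iso_sep:
  assumes "sep X \<delta>" and iso: "diversity_iso X \<delta> Y \<rho> \<phi>"
  shows "sep Y \<rho>"
proof -
  have Y: "\<phi> ` X = Y" and eq: "\<And>A. A \<in> Fpow X \<Longrightarrow> \<rho> (\<phi> ` A) = \<delta> A"
    using iso by (auto simp: diversity_iso_def bij_betw_def)
  have eq2: "\<rho> {\<phi> x, \<phi> y} = \<delta> {x, y}" if "x \<in> X" "y \<in> X" for x y
    using eq[of "{x, y}"] that by (simp add: Fpow_iff)
  obtain D where D: "countable D" "D \<subseteq> X" "\<And>x e. x \<in> X \<Longrightarrow> e > 0 \<Longrightarrow> \<exists>y\<in>D. \<delta> {x, y} < e"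
    using assms(1) unfolding sep_def by blast
  have "\<exists>y\<in>\<phi> ` D. \<rho> {\<phi> x, y} < e" if "x \<in> X" "e > 0" for x e
    using D(3)[OF that] D(2) that(1) eq2 by (metis image_eqI subsetD)
  then show ?thesis
    unfolding sep_def Y[symmetric] using D(1,2)
    by (intro exI[of _ "\<phi> ` D"]) auto
qed

context
  fixes X :: "'a set" and \<delta> :: "'a set \<Rightarrow> real"
  assumes div: "diversity X \<delta>" and nonempty: "X \<noteq> {}"
begin

private abbreviation (input) L where "L n \<equiv> fst (level X \<delta> n)"
private abbreviation (input) d where "d n \<equiv> snd (level X \<delta> n)"

lemma level_Suc:
  "L (Suc n) = name n (L n) (d n) ` E_omega (L n) (d n)"
  "d (Suc n) A = hat (L n) {g \<in> E_omega (L n) (d n). name n (L n) (d n) g \<in> A}"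
  by (simp_all add: Let_def case_prod_beta)

text \<open>The next level measures a set through its preimage under \<open>name\<close>. Freshness
  of the tag n makes \<open>name\<close> injective, so the preimage of an image is the original
  set.\<close>

lemma level_iso:
  "diversity_iso (E_omega (L n) (d n)) (hat (L n)) (L (Suc n)) (d (Suc n)) (name n (L n) (d n))"
proof -
  have inj: "inj_on (name n (L n) (d n)) (E_omega (L n) (d n))"
    by (rule inj_on_name) (simp add: level_fresh)
  have "{g \<in> E_omega (L n) (d n). name n (L n) (d n) g \<in> name n (L n) (d n) ` A} = A"
    if "A \<in> Fpow (E_omega (L n) (d n))" for A
    using inj that by (auto simp: Fpow_iff dest: inj_onD)
  then show ?thesis
    using inj unfolding diversity_iso_def level_Suc by (auto simp: bij_betw_def)
qed

lemma diversity_E_omega: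
  assumes "diversity Z \<rho>" "Z \<noteq> {}"
  shows "diversity (E_omega Z \<rho>) (hat Z)"
  by (rule diversity_subset[OF diversity_hat[OF assms]]) (auto simp: E_omega_def)

lemma level_iso_0: "diversity_iso X \<delta> (L 0) (d 0) Base"
  by (auto simp: diversity_iso_def bij_betw_def inj_on_def inj_vimage_image_eq)

lemma level_diversity: "diversity (L n) (d n) \<and> L n \<noteq> {}"
proof (induction n)
  case 0
  then show ?case
    using diversity_iso_diversity[OF div level_iso_0] nonempty by simp
next
  case (Suc n)
  then obtain x where "x \<in> L n"
    by blast
  then have "E_omega (L n) (d n) \<noteq> {}"
    using kappa_in_E_omega[of "L n" "d n" x] Suc by blast
  then show ?case
    using Suc diversity_iso_diversity[OF diversity_E_omega level_iso]
    by (simp add: level_Suc(1) del: level.simps)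
qed

lemmas div_level = level_diversity[THEN conjunct1]
  and level_nonempty = level_diversity[THEN conjunct2]

lemma level_sep:
  assumes "sep X \<delta>"
  shows "sep (L n) (d n)"
proof (induction n)
  case 0
  then show ?case
    by (rule diversity_iso_sep[OF assms level_iso_0])
next
  case (Suc n)
  then show ?case
    by (intro diversity_iso_sep[OF sep_E_omega level_iso] div_level level_nonempty)
qed

text \<open>\<open>name\<close> sends the function of x back to x, so the image of g and the
  embedded points of \<open>A\<close> is the new point together with \<open>A\<close> itself, and
  \<open>hat_insert_kappa\<close> applies.\<close>

lemma level_Suc_insert:
  assumes g: "g \<in> E_omega (L n) (d n)" and A: "A \<in> Fpow (L n)"
  shows "d (Suc n) (insert (name n (L n) (d n) g) A) = g A"
proof -
  let ?k = "kappa (L n) (d n)"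
  have "name n (L n) (d n) ` insert g (?k ` A) = insert (name n (L n) (d n) g) A"
    using A by (auto simp: image_image Fpow_iff name_kappa[OF div_level] subset_iff cong: image_cong)
  moreover have "insert g (?k ` A) \<in> Fpow (E_omega (L n) (d n))"
    using g A kappa_in_E_omega[OF div_level] by (auto simp: Fpow_iff)
  ultimately have "d (Suc n) (insert (name n (L n) (d n) g) A) = hat (L n) (insert g (?k ` A))"
    using level_iso[of n] unfolding diversity_iso_def by metis
  also have "\<dots> = g A"
    using g A by (intro hat_insert_kappa div_level level_nonempty) (auto simp: E_omega_def)
  finally show ?thesis .
qed

lemma level_step:
  shows "L n \<subseteq> L (Suc n)" "A \<in> Fpow (L n) \<Longrightarrow> d (Suc n) A = d n A"
proof -
  show "L n \<subseteq> L (Suc n)"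
  proof
    fix x assume x: "x \<in> L n"
    then have "name n (L n) (d n) (kappa (L n) (d n) x) \<in> L (Suc n)"
      unfolding level_Suc using kappa_in_E_omega[OF div_level] by blast
    then show "x \<in> L (Suc n)"
      using name_kappa[OF div_level x] by simp
  qed
  have div': "diversity (L (Suc n)) (d (Suc n))"
    by (rule div_level)
  show "d (Suc n) A = d n A" if A: "A \<in> Fpow (L n)"
  proof (cases "A = {}")
    case True
    then show ?thesis
      using diversity_empty[OF div_level] diversity_empty[OF div'] by metis
  next
    case False
    then obtain x where x: "x \<in> A"
      by blast
    then have xL: "x \<in> L n" "insert x A = A"
      using A by (auto simp: Fpow_iff)
    \<comment> \<open>The preceding lemma for g the function of x, whose name is x; since x lies in
      \<open>A\<close>, nothing is added.\<close>
    have "d (Suc n) (insert x A) = kappa (L n) (d n) x A"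
      using level_Suc_insert[OF kappa_in_E_omega[OF div_level xL(1)] A] name_kappa[OF div_level xL(1), of n]
      by metis
    then show ?thesis
      using A xL by (simp add: kappa_def)
  qed
qed

lemma level_mono:
  assumes "n \<le> m"
  shows "L n \<subseteq> L m" "A \<in> Fpow (L n) \<Longrightarrow> d m A = d n A"
proof -
  have "L n \<subseteq> L m \<and> (\<forall>A\<in>Fpow (L n). d m A = d n A)"
    using assms
  proof (induction m rule: dec_induct)
    case (step m)
    then have "A \<in> Fpow (L m)" if "A \<in> Fpow (L n)" for A
      using that Fpow_mono by blast
    then show ?case
      using step level_step by (metis subset_trans)
  qed simp
  then show "L n \<subseteq> L m" "A \<in> Fpow (L n) \<Longrightarrow> d m A = d n A"
    by auto
qed

section \<open>The direct limit\<close>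

lemma omega_div_level:
  assumes "A \<in> Fpow (L n)"
  shows "omega_div X \<delta> A = d n A"
proof -
  let ?m = "LEAST n. A \<subseteq> L n"
  have "A \<subseteq> L n"
    using assms by (simp add: Fpow_iff)
  then have "A \<subseteq> L ?m" "?m \<le> n"
    by (auto intro: LeastI2 Least_le)
  then show ?thesis
    using level_mono(2)[of ?m n A] assms by (simp add: omega_div_def Fpow_iff)
qed

lemma level_subset_omega: "L n \<subseteq> omega_set X \<delta>"
  by (auto simp: omega_set_def)

lemma omega_level:
  assumes "A \<in> Fpow (omega_set X \<delta>)"
  obtains n where "A \<in> Fpow (L n)"
proof -
  have "finite A" "A \<subseteq> omega_set X \<delta>"
    using assms by (auto simp: Fpow_iff)
  then have "\<exists>n. A \<in> Fpow (L n)"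
  proof (induction A rule: finite_induct)
    case empty
    then show ?case by (auto simp: Fpow_iff)
  next
    case (insert x A)
    then obtain n m where "A \<in> Fpow (L n)" "x \<in> L m"
      by (auto simp: omega_set_def)
    then have "insert x A \<in> Fpow (L (max n m))"
      using level_mono(1)[of n "max n m"] level_mono(1)[of m "max n m"] by (auto simp: Fpow_iff)
    then show ?case by blast
  qed
  then show ?thesis
    using that by blast
qed

lemma diversity_omega: "diversity (omega_set X \<delta>) (omega_div X \<delta>)"
  unfolding diversity_def
proof (intro conjI ballI impI)
  fix A assume "A \<in> Fpow (omega_set X \<delta>)"
  then obtain n where n: "A \<in> Fpow (L n)"
    by (rule omega_level)
  show "0 \<le> omega_div X \<delta> A" "omega_div X \<delta> A = 0 \<longleftrightarrow> card A \<le> 1"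
    using diversity_nonneg[OF div_level n] diversity_zero[OF div_level n] omega_div_level[OF n]
    by simp_all
next
  fix A B C assume *: "A \<in> Fpow (omega_set X \<delta>)" "B \<in> Fpow (omega_set X \<delta>)" "C \<in> Fpow (omega_set X \<delta>)"
    and "B \<noteq> {}"
  then have "A \<union> B \<union> C \<in> Fpow (omega_set X \<delta>)"
    by (intro Fpow_Un)
  then obtain n where "A \<union> B \<union> C \<in> Fpow (L n)"
    by (rule omega_level)
  then have n: "A \<in> Fpow (L n)" "B \<in> Fpow (L n)" "C \<in> Fpow (L n)"
    by (auto simp: Fpow_iff)
  show "omega_div X \<delta> (A \<union> C) \<le> omega_div X \<delta> (A \<union> B) + omega_div X \<delta> (B \<union> C)"
    using div_level[of n] n \<open>B \<noteq> {}\<close> by (simp add: omega_div_level[of _ n] Fpow_Un diversity_def)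
qed

lemma sep_omega:
  assumes "sep X \<delta>"
  shows "sep (omega_set X \<delta>) (omega_div X \<delta>)"
proof -
  have "\<exists>D. countable D \<and> D \<subseteq> L n \<and> (\<forall>x\<in>L n. \<forall>e>0. \<exists>y\<in>D. d n {x, y} < e)" for n
    using level_sep[OF assms, of n] by (simp add: sep_def)
  then obtain D where D: "\<And>n. countable (D n)" "\<And>n. D n \<subseteq> L n"
      "\<And>n x e. x \<in> L n \<Longrightarrow> e > 0 \<Longrightarrow> \<exists>y\<in>D n. d n {x, y} < e"
    by metis
  have "\<exists>y\<in>\<Union>n. D n. omega_div X \<delta> {x, y} < e" if x: "x \<in> omega_set X \<delta>" and e: "e > 0" for x e
  proof -
    obtain n where n: "x \<in> L n"
      using x by (auto simp: omega_set_def)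
    obtain y where y: "y \<in> D n" "d n {x, y} < e"
      using D(3)[OF n e] by blast
    have "omega_div X \<delta> {x, y} = d n {x, y}"
      using n y D(2) by (intro omega_div_level) (auto simp: Fpow_iff)
    then show ?thesis
      using y by (metis UN_iff UNIV_I)
  qed
  moreover have "countable (\<Union>n. D n)" "(\<Union>n. D n) \<subseteq> omega_set X \<delta>"
    using D(1,2) level_subset_omega by (auto dest!: subsetD[OF D(2)] intro: subsetD[OF level_subset_omega])
  ultimately show ?thesis
    unfolding sep_def by blast
qed

text \<open>Besides being a nonempty diversity, this is all that universality asks of the limit.
  \<open>support_extension\<close> carries f from \<open>S\<close> to a whole level without changing
  its values on \<open>S\<close>, and the result is a point of the next level.\<close>

lemma omega_extension:
  assumes S: "S \<in> Fpow (omega_set X \<delta>)" "S \<noteq> {}" and f: "adm S (omega_div X \<delta>) f"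
  shows "\<exists>z\<in>omega_set X \<delta>. \<forall>A\<in>Fpow S. omega_div X \<delta> (insert z A) = f A"
proof -
  obtain n where n: "S \<in> Fpow (L n)"
    using omega_level[OF S(1)] .
  then have S': "finite S" "S \<subseteq> L n"
    by (auto simp: Fpow_iff)
  have sub: "A \<in> Fpow (L n)" if "A \<in> Fpow S" for A
    using that S' by (auto simp: Fpow_iff)
  have f': "adm S (d n) f"
    using f by (simp add: adm_def lip_functional_def omega_div_level[OF sub] Fpow_Un)
  let ?g = "support_extension (L n) (d n) S f"
  let ?z = "name n (L n) (d n) ?g"
  have g: "?g \<in> E_omega (L n) (d n)"
    by (rule support_extension_in_E_omega[OF div_level S'(2) S(2) S'(1) f'])
  have z: "?z \<in> L (Suc n)"
    unfolding level_Suc using g by blast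
  show ?thesis
  proof (intro bexI ballI)
    show "?z \<in> omega_set X \<delta>"
      using z level_subset_omega by blast
    fix A assume A: "A \<in> Fpow S"
    have "insert ?z A \<in> Fpow (L (Suc n))"
      using z sub[OF A] level_step(1)[of n] by (auto simp: Fpow_iff)
    then have "omega_div X \<delta> (insert ?z A) = d (Suc n) (insert ?z A)"
      by (rule omega_div_level)
    also have "\<dots> = ?g A"
      by (rule level_Suc_insert[OF g sub[OF A]])
    also have "\<dots> = f A"
      by (rule support_extension_eq[OF div_level S'(2) S(2) f' A])
    finally show "omega_div X \<delta> (insert ?z A) = f A" .
  qed
qed

lemma omega_nonempty: "omega_set X \<delta> \<noteq> {}"
  using level_nonempty[of 0] level_subset_omega[of 0] by auto

end

section \<open>The completion\<close>

context
  fixes X :: "'a set" and \<delta> :: "'a set \<Rightarrow> real"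
  assumes div: "diversity X \<delta>"
begin

lemma diversity_dist:
  assumes "x \<in> X" "y \<in> X"
  shows "induced_dist X \<delta> x y = \<delta> {x, y}" "0 \<le> \<delta> {x, y}"
  using assms diversity_nonneg[OF div, of "{x, y}"] by (simp_all add: induced_dist_def Fpow_iff)

lemma diversity_triangle:
  assumes "x \<in> X" "y \<in> X" "z \<in> X"
  shows "\<delta> {x, z} \<le> \<delta> {x, y} + \<delta> {y, z}"
proof -
  have "\<delta> {x, z} \<le> \<delta> ({x, y} \<union> {y, z})"
    using assms by (intro diversity_mono[OF div]) (auto simp: Fpow_iff)
  also have "\<dots> \<le> \<delta> {x, y} + \<delta> {y, z}"
    using assms by (intro diversity_join[OF div, of _ _ y]) (auto simp: Fpow_iff)
  finally show ?thesis .
qed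

lemma Metric_space_diversity: "Metric_space X (induced_dist X \<delta>)"
proof
  fix x y z
  show "0 \<le> induced_dist X \<delta> x y" "induced_dist X \<delta> x y = induced_dist X \<delta> y x"
    using diversity_dist[of x y] by (auto simp: induced_dist_def insert_commute)
  show "x \<in> X \<Longrightarrow> y \<in> X \<Longrightarrow> induced_dist X \<delta> x y = 0 \<longleftrightarrow> x = y"
    by (simp add: diversity_dist diversity_pair[OF div])
  show "x \<in> X \<Longrightarrow> y \<in> X \<Longrightarrow> z \<in> X \<Longrightarrow> induced_dist X \<delta> x z \<le> induced_dist X \<delta> x y + induced_dist X \<delta> y z"
    by (simp add: diversity_dist diversity_triangle)
qed

interpretation Metric_space X "induced_dist X \<delta>"
  by (rule Metric_space_diversity)

lemma separable_iff_sep: "separable_space mtopology \<longleftrightarrow> sep X \<delta>"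
proof -
  have "mtopology closure_of D = X \<longleftrightarrow> (\<forall>x\<in>X. \<forall>e>0. \<exists>y\<in>D. \<delta> {x, y} < e)" if "D \<subseteq> X" for D
  proof -
    have "y \<in> mball x e \<longleftrightarrow> \<delta> {x, y} < e" if "x \<in> X" "y \<in> D" for x y e
      using that \<open>D \<subseteq> X\<close> by (auto simp: in_mball diversity_dist)
    then have "mtopology closure_of D = {x \<in> X. \<forall>e>0. \<exists>y\<in>D. \<delta> {x, y} < e}"
      unfolding metric_closure_of by (intro Collect_cong conj_cong) auto
    then show ?thesis
      by blast
  qed
  then show ?thesis
    unfolding separable_space_def sep_def topspace_mtopology by metis
qed

lemma MCauchy_iff:
  "MCauchy s \<longleftrightarrow> range s \<subseteq> X \<and> (\<forall>e>0. \<exists>N. \<forall>n\<ge>N. \<forall>m\<ge>N. \<delta> {s n, s m} < e)"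
  unfolding MCauchy_def by (auto simp: diversity_dist range_subsetD)

lemma MCauchy_in: "MCauchy s \<Longrightarrow> s n \<in> X"
  by (auto simp: MCauchy_def)

text \<open>The points \<open>y i\<close> are traded for the \<open>x i\<close> one at a time.
  Indexing by \<open>I\<close> admits repetitions, which can occur when several Cauchy sequences are
  followed at once.\<close>

lemma diversity_perturb:
  assumes "finite I" "\<And>i. i \<in> I \<Longrightarrow> x i \<in> X" "\<And>i. i \<in> I \<Longrightarrow> y i \<in> X"
  shows "\<bar>\<delta> (x ` I) - \<delta> (y ` I)\<bar> \<le> (\<Sum>i\<in>I. \<delta> {x i, y i})"
proof -
  have le: "\<delta> (x ` I) \<le> \<delta> (y ` I) + (\<Sum>i\<in>I. \<delta> {y i, x i})"
    if "\<And>i. i \<in> I \<Longrightarrow> x i \<in> X" "\<And>i. i \<in> I \<Longrightarrow> y i \<in> X" for x y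
    using lip_functional_UN[OF diversity_lip[OF div] assms(1), of "{}" "\<lambda>i. {x i}" y] that
    by (simp add: Fpow_iff UNION_singleton_eq_range)
  show ?thesis
    using le[of x y] le[of y x] assms by (simp add: abs_le_iff insert_commute)
qed

lemma diversity_tendsto_cong:
  assumes "finite I" "\<And>i n. i \<in> I \<Longrightarrow> s i n \<in> X" "\<And>i n. i \<in> I \<Longrightarrow> t i n \<in> X"
    and lim: "\<And>i. i \<in> I \<Longrightarrow> (\<lambda>n. \<delta> {s i n, t i n}) \<longlonglongrightarrow> 0"
    and l: "(\<lambda>n. \<delta> ((\<lambda>i. s i n) ` I)) \<longlonglongrightarrow> l"
  shows "(\<lambda>n. \<delta> ((\<lambda>i. t i n) ` I)) \<longlonglongrightarrow> l"
proof -
  have "(\<lambda>n. \<Sum>i\<in>I. \<delta> {s i n, t i n}) \<longlonglongrightarrow> 0"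
    using lim by (rule tendsto_null_sum)
  then have "(\<lambda>n. \<delta> ((\<lambda>i. s i n) ` I) - \<delta> ((\<lambda>i. t i n) ` I)) \<longlonglongrightarrow> 0"
    by (rule Lim_null_comparison[rotated])
      (use assms in \<open>auto intro!: always_eventually diversity_perturb\<close>)
  from tendsto_diff[OF l this] show ?thesis
    by simp
qed

lemma diversity_convergent:
  assumes I: "finite I" and s: "\<And>i. i \<in> I \<Longrightarrow> MCauchy (s i)"
  shows "convergent (\<lambda>n. \<delta> ((\<lambda>i. s i n) ` I))"
proof -
  have in_X: "s i n \<in> X" if "i \<in> I" for i n
    using s[OF that] by (auto simp: MCauchy_iff)
  have "\<exists>N. \<forall>m\<ge>N. \<forall>n\<ge>N. \<bar>\<delta> ((\<lambda>i. s i m) ` I) - \<delta> ((\<lambda>i. s i n) ` I)\<bar> < e" if e: "e > 0" for e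
  proof -
    \<comment> \<open>The \<open>+ 1\<close> avoids division by zero for empty \<open>I\<close> and
      makes the last inequality strict.\<close>
    let ?e = "e / (real (card I) + 1)"
    have "?e > 0"
      using e by (simp add: add_nonneg_pos)
    then have "\<forall>i\<in>I. \<exists>N. \<forall>n\<ge>N. \<forall>m\<ge>N. \<delta> {s i n, s i m} < ?e"
      using s unfolding MCauchy_iff by blast
    then obtain N where N: "\<And>i n m. i \<in> I \<Longrightarrow> n \<ge> N i \<Longrightarrow> m \<ge> N i \<Longrightarrow> \<delta> {s i n, s i m} < ?e"
      by metis
    \<comment> \<open>The sum of the \<open>N i\<close> is a common threshold, also when
      \<open>I\<close> is empty.\<close>
    have "\<bar>\<delta> ((\<lambda>i. s i m) ` I) - \<delta> ((\<lambda>i. s i n) ` I)\<bar> < e"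
      if mn: "m \<ge> (\<Sum>i\<in>I. N i)" "n \<ge> (\<Sum>i\<in>I. N i)" for m n
    proof -
      have le: "N i \<le> (\<Sum>i\<in>I. N i)" if "i \<in> I" for i
        using I that by (intro member_le_sum) auto
      have "\<bar>\<delta> ((\<lambda>i. s i m) ` I) - \<delta> ((\<lambda>i. s i n) ` I)\<bar> \<le> (\<Sum>i\<in>I. \<delta> {s i m, s i n})"
        using I in_X by (intro diversity_perturb) auto
      also have "\<dots> \<le> real (card I) * ?e"
        using order.trans[OF le mn(1)] order.trans[OF le mn(2)]
        by (intro sum_bounded_above less_imp_le[OF N])
      also have "\<dots> < e"
        using e by (simp add: field_simps add_nonneg_pos)
      finally show ?thesis .
    qed
    then show ?thesis
      by blast
  qed
  then show ?thesis
    unfolding Cauchy_convergent_iff[symmetric] Cauchy_def dist_real_def by blast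
qed

private abbreviation (input) R where "R \<equiv> cauchy_rel X \<delta>"
private abbreviation (input) C where "C \<equiv> completion_set X \<delta>"
private abbreviation (input) dC where "dC \<equiv> completion_div \<delta>"

lemma cauchy_rel_iff:
  "(s, t) \<in> R \<longleftrightarrow> MCauchy s \<and> MCauchy t \<and> (\<lambda>n. \<delta> {s n, t n}) \<longlonglongrightarrow> 0"
proof -
  have "induced_dist X \<delta> (s n) (t n) = \<delta> {s n, t n}" if "MCauchy s" "MCauchy t" for n
    using that by (intro diversity_dist(1) MCauchy_in)
  then show ?thesis
    unfolding cauchy_rel_def by auto
qed

lemma equiv_cauchy_rel: "equiv {s. MCauchy s} R"
proof (rule equivI)
  show "R \<subseteq> {s. MCauchy s} \<times> {s. MCauchy s}"
    by (auto simp: cauchy_rel_iff)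
  show "refl_on {s. MCauchy s} R"
  proof (rule refl_onI)
    fix s assume "s \<in> {s. MCauchy s}"
    then show "(s, s) \<in> R"
      by (simp add: cauchy_rel_iff diversity_single[OF div MCauchy_in])
  qed
  show "sym R"
  proof (rule symI)
    fix s t assume "(s, t) \<in> R"
    then show "(t, s) \<in> R"
      by (simp add: cauchy_rel_iff insert_commute)
  qed
  show "trans R"
  proof (rule transI)
    fix s t u assume st: "(s, t) \<in> R" and tu: "(t, u) \<in> R"
    then have "MCauchy s" "MCauchy t" "MCauchy u"
      by (simp_all add: cauchy_rel_iff)
    then have in_X: "s n \<in> X" "t n \<in> X" "u n \<in> X" for n
      by (simp_all add: MCauchy_in)
    have lims: "(\<lambda>n. \<delta> {s n, t n}) \<longlonglongrightarrow> 0" "(\<lambda>n. \<delta> {t n, u n}) \<longlonglongrightarrow> 0"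
      using st tu by (simp_all add: cauchy_rel_iff)
    have "norm (\<delta> {s n, u n}) \<le> \<delta> {s n, t n} + \<delta> {t n, u n}" for n
      using diversity_triangle[of "s n" "t n" "u n"] diversity_dist(2)[of "s n" "u n"] in_X by simp
    then have "(\<lambda>n. \<delta> {s n, u n}) \<longlonglongrightarrow> 0"
      by (intro Lim_null_comparison[OF always_eventually tendsto_add_zero[OF lims]] allI)
    then show "(s, u) \<in> R"
      using st tu by (simp add: cauchy_rel_iff)
  qed
qed

lemma completion_member:
  assumes "c \<in> C" "s \<in> c"
  shows "MCauchy s" "s n \<in> X"
proof -
  show "MCauchy s"
    using in_quotient_imp_subset[OF equiv_cauchy_rel] assms unfolding completion_set_def by blast
  then show "s n \<in> X"
    by (rule MCauchy_in)
qed

lemma completion_nonempty: "c \<in> C \<Longrightarrow> \<exists>s. s \<in> c"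
  unfolding completion_set_def using in_quotient_imp_non_empty[OF equiv_cauchy_rel] by blast

lemma completion_class:
  assumes "MCauchy s"
  shows "R `` {s} \<in> C" "s \<in> R `` {s}"
  using assms equiv_class_self[OF equiv_cauchy_rel] unfolding completion_set_def
  by (auto intro: quotientI)

text \<open>\<open>completion_div\<close> picks representatives by \<open>SOME\<close>; any others
  in the same classes give the same limit by \<open>diversity_tendsto_cong\<close>.\<close>

lemma completion_div_tendsto:
  assumes I: "finite I" and c: "\<And>i. i \<in> I \<Longrightarrow> c i \<in> C" and s: "\<And>i. i \<in> I \<Longrightarrow> s i \<in> c i"
  shows "(\<lambda>n. \<delta> ((\<lambda>i. s i n) ` I)) \<longlonglongrightarrow> dC (c ` I)"
proof -
  let ?r = "\<lambda>i. SOME s. s \<in> c i"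
  have r: "?r i \<in> c i" if "i \<in> I" for i
    using completion_nonempty[OF c[OF that]] by (rule someI_ex)
  have cauchy: "MCauchy (?r i)" if "i \<in> I" for i
    using completion_member(1)[OF c r] that by blast
  have "(\<lambda>n. \<delta> ((\<lambda>i. ?r i n) ` I)) \<longlonglongrightarrow> dC (c ` I)"
    using diversity_convergent[OF I cauchy] unfolding completion_div_def convergent_LIMSEQ_iff image_image .
  moreover have "(\<lambda>n. \<delta> {?r i n, s i n}) \<longlonglongrightarrow> 0" if "i \<in> I" for i
  proof -
    have "(?r i, s i) \<in> R"
      using in_quotient_imp_in_rel[OF equiv_cauchy_rel] c[OF that] r[OF that] s[OF that]
      unfolding completion_set_def by blast
    then show ?thesis
      by (simp add: cauchy_rel_iff)
  qed
  ultimately show ?thesis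
    using I completion_member(2)[OF c r] completion_member(2)[OF c s]
    by (intro diversity_tendsto_cong[of I ?r s]) auto
qed

lemma completion_pair_tendsto:
  assumes "c \<in> C" "c' \<in> C" "s \<in> c" "t \<in> c'"
  shows "(\<lambda>n. \<delta> {s n, t n}) \<longlonglongrightarrow> dC {c, c'}"
proof -
  \<comment> \<open>Indexing by booleans lets one class occur with two different
    representatives.\<close>
  have "(\<lambda>n. \<delta> ((\<lambda>b. (if b then s else t) n) ` {True, False})) \<longlonglongrightarrow>
      dC ((\<lambda>b. if b then c else c') ` {True, False})"
    using assms by (intro completion_div_tendsto) auto
  then show ?thesis
    by (simp add: insert_commute)
qed

text \<open>Weak inequalities pass to the limit along fixed representatives. Strict positivity on
  pairs comes from the quotient instead: limit 0 means that the two sequences are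
  equivalent.\<close>

lemma diversity_completion: "diversity C dC"
proof -
  obtain r where r_class: "\<And>c. c \<in> C \<Longrightarrow> r c \<in> c"
    using completion_nonempty by metis
  note r = r_class completion_member(2)[OF _ r_class]
  have lim: "(\<lambda>n. \<delta> ((\<lambda>c. r c n) ` F)) \<longlonglongrightarrow> dC F" if "F \<in> Fpow C" for F
    using completion_div_tendsto[of F "\<lambda>c. c" r] r(1) that by (auto simp: Fpow_iff)
  have in_X: "(\<lambda>c. r c n) ` F \<in> Fpow X" if "F \<in> Fpow C" for F n
    using that r(2) by (auto simp: Fpow_iff)
  show ?thesis
  proof (rule diversityI)
    show "dC {} = 0"
      using LIMSEQ_unique[OF lim[of "{}"]] diversity_empty[OF div] by (simp add: Fpow_iff)
    fix c assume c: "c \<in> C"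
    show "dC {c} = 0"
      using LIMSEQ_unique[OF lim[of "{c}"]] c diversity_single[OF div r(2)[OF c]] by (simp add: Fpow_iff)
    fix c' assume c': "c' \<in> C" and "c \<noteq> c'"
    have pair: "(\<lambda>n. \<delta> {r c n, r c' n}) \<longlonglongrightarrow> dC {c, c'}"
      using c c' r by (intro completion_pair_tendsto)
    have "0 \<le> dC {c, c'}"
      using c c' r by (intro LIMSEQ_le_const[OF pair]) (auto simp: diversity_dist(2))
    moreover have "dC {c, c'} \<noteq> 0"
    proof
      assume "dC {c, c'} = 0"
      then have "(r c, r c') \<in> R"
        using pair completion_member(1) c c' r by (auto simp: cauchy_rel_iff)
      then have "c = c'"
        using quotient_eqI[OF equiv_cauchy_rel] c c' r unfolding completion_set_def by blast
      then show False
        using \<open>c \<noteq> c'\<close> by simp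
    qed
    ultimately show "0 < dC {c, c'}"
      by simp
  next
    fix F G assume G: "G \<in> Fpow C" and "F \<subseteq> G"
    then have F: "F \<in> Fpow C"
      by (auto simp: Fpow_iff finite_subset)
    show "dC F \<le> dC G"
      using \<open>F \<subseteq> G\<close> by (intro LIMSEQ_le[OF lim[OF F] lim[OF G]]) (auto intro!: diversity_mono[OF div in_X[OF G]])
  next
    fix F G c assume F: "F \<in> Fpow C" and G: "G \<in> Fpow C" and c: "c \<in> F" "c \<in> G"
    have "\<delta> ((\<lambda>c. r c n) ` (F \<union> G)) \<le> \<delta> ((\<lambda>c. r c n) ` F) + \<delta> ((\<lambda>c. r c n) ` G)" for n
      unfolding image_Un using c by (intro diversity_join[OF div in_X[OF F] in_X[OF G]]) auto
    then show "dC (F \<union> G) \<le> dC F + dC G"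
      by (intro LIMSEQ_le[OF lim[OF Fpow_Un[OF F G]] tendsto_add[OF lim[OF F] lim[OF G]]]) auto
  qed
qed

section \<open>The dense copy of the space in its completion\<close>

definition const_class :: "'a \<Rightarrow> (nat \<Rightarrow> 'a) set" where "const_class x = R `` {\<lambda>_. x}"

lemma const_class_in:
  assumes "x \<in> X"
  shows "const_class x \<in> C" "(\<lambda>_. x) \<in> const_class x"
proof -
  have "MCauchy (\<lambda>_. x)"
    using assms diversity_single[OF div assms] by (simp add: MCauchy_iff image_subset_iff)
  then show "const_class x \<in> C" "(\<lambda>_. x) \<in> const_class x"
    unfolding const_class_def by (rule completion_class)+
qed

lemma const_class_pair:
  assumes "x \<in> X" "y \<in> X"
  shows "dC {const_class x, const_class y} = \<delta> {x, y}"
proof -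
  have "(\<lambda>_. \<delta> {x, y}) \<longlonglongrightarrow> dC {const_class x, const_class y}"
    using assms by (intro completion_pair_tendsto const_class_in)
  then show ?thesis
    by (simp add: LIMSEQ_const_iff)
qed

lemma const_class_tendsto:
  assumes c: "c \<in> C" and s: "s \<in> c"
  shows "(\<lambda>n. dC {c, const_class (s n)}) \<longlonglongrightarrow> 0"
proof (rule LIMSEQ_I)
  fix e :: real assume e: "e > 0"
  have "e / 2 > 0"
    using e by simp
  then obtain N where N: "\<forall>n\<ge>N. \<forall>m\<ge>N. \<delta> {s n, s m} < e / 2"
    using completion_member(1)[OF c s] unfolding MCauchy_iff by presburger
  have "norm (dC {c, const_class (s n)} - 0) < e" if n: "n \<ge> N" for n
  proof -
    have sn: "s n \<in> X"
      by (rule completion_member(2)[OF c s])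
    have lim: "(\<lambda>m. \<delta> {s m, s n}) \<longlonglongrightarrow> dC {c, const_class (s n)}"
      using completion_pair_tendsto[OF c const_class_in(1)[OF sn] s const_class_in(2)[OF sn]] .
    have "dC {c, const_class (s n)} \<le> e / 2"
      using N n by (intro LIMSEQ_le_const2[OF lim] exI[of _ N]) (simp add: less_imp_le)
    moreover have "0 \<le> dC {c, const_class (s n)}"
      using c const_class_in(1)[OF sn] by (intro diversity_nonneg[OF diversity_completion]) (simp add: Fpow_iff)
    ultimately show ?thesis
      using e by simp
  qed
  then show "\<exists>N. \<forall>n\<ge>N. norm (dC {c, const_class (s n)} - 0) < e"
    by blast
qed

lemma const_class_dense:
  assumes c: "c \<in> C" and e: "e > 0"
  obtains x where "x \<in> X" "dC {c, const_class x} < e"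
proof -
  obtain s where s: "s \<in> c"
    using completion_nonempty[OF c] by blast
  obtain n where "norm (dC {c, const_class (s n)} - 0) < e"
    using LIMSEQ_D[OF const_class_tendsto[OF c s] e] by blast
  then show ?thesis
    using that[of "s n"] completion_member(2)[OF c s] by simp
qed

end

context
  fixes X :: "'a set" and \<delta> :: "'a set \<Rightarrow> real"
  assumes div: "diversity X \<delta>"
begin

private abbreviation (input) C' where "C' \<equiv> completion_set X \<delta>"
private abbreviation (input) dC' where "dC' \<equiv> completion_div \<delta>"

lemmas divC = diversity_completion[OF div]

lemma sep_completion:
  assumes "sep X \<delta>"
  shows "sep C' dC'"
proof -
  obtain D where D: "countable D" "D \<subseteq> X" "\<And>x e. x \<in> X \<Longrightarrow> e > 0 \<Longrightarrow> \<exists>y\<in>D. \<delta> {x, y} < e"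
    using assms unfolding sep_def by blast
  have "\<exists>y\<in>const_class X \<delta> ` D. dC' {c, y} < e" if c: "c \<in> C'" and e: "e > 0" for c e
  proof -
    have e2: "e / 2 > 0"
      using e by simp
    obtain x where x: "x \<in> X" "dC' {c, const_class X \<delta> x} < e / 2"
      using const_class_dense[OF div c e2] by blast
    obtain y where y: "y \<in> D" "\<delta> {x, y} < e / 2"
      using D(3)[OF x(1) e2] by blast
    have yX: "y \<in> X"
      using y D by auto
    have "dC' {c, const_class X \<delta> y} \<le> dC' {c, const_class X \<delta> x} + dC' {const_class X \<delta> x, const_class X \<delta> y}"
      using c x yX by (intro diversity_triangle[OF divC] const_class_in(1)[OF div])
    then show ?thesis
      using x y yX const_class_pair[OF div] by (intro bexI[of _ "const_class X \<delta> y"]) auto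
  qed
  moreover have "const_class X \<delta> ` D \<subseteq> C'"
    using D(2) const_class_in(1)[OF div] by auto
  ultimately show ?thesis
    unfolding sep_def by (intro exI[of _ "const_class X \<delta> ` D"] conjI countable_image D(1) ballI allI impI)
qed

text \<open>Each \<open>\<sigma> n\<close> is within \<open>1 / (n + 1)\<close> of the class of a
  constant sequence at some \<open>x n\<close>. The sequence x is then Cauchy, and its own class is
  the limit, because it and \<open>\<sigma> n\<close> both approach the class of the constant
  \<open>x n\<close>.\<close>

lemma complete_completion: "complete_diversity C' dC'"
proof -
  interpret C: Metric_space C' "induced_dist C' dC'"
    by (rule Metric_space_diversity[OF divC])
  have "\<exists>c. limitin C.mtopology \<sigma> c sequentially" if \<sigma>: "C.MCauchy \<sigma>" for \<sigma>
  proof -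
    have \<sigma>C: "\<sigma> n \<in> C'" for n
      using \<sigma> by (auto simp: C.MCauchy_def)
    have "\<exists>x. x \<in> X \<and> dC' {\<sigma> n, const_class X \<delta> x} < inverse (real (Suc n))" for n
      using const_class_dense[OF div \<sigma>C[of n], of "inverse (real (Suc n))"] by auto
    then obtain x where x: "\<And>n. x n \<in> X" "\<And>n. dC' {\<sigma> n, const_class X \<delta> (x n)} < inverse (real (Suc n))"
      by metis
    have iC: "const_class X \<delta> (x n) \<in> C'" for n
      by (rule const_class_in(1)[OF div x(1)])
    have near: "(\<lambda>n. dC' {\<sigma> n, const_class X \<delta> (x n)}) \<longlonglongrightarrow> 0"
    proof (rule Lim_null_comparison[OF always_eventually LIMSEQ_inverse_real_of_nat], intro allI)
      fix n
      show "norm (dC' {\<sigma> n, const_class X \<delta> (x n)}) \<le> inverse (real (Suc n))"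
        using x(2)[of n] diversity_dist(2)[OF divC \<sigma>C[of n] iC[of n]] by simp
    qed
    have "Metric_space.MCauchy X (induced_dist X \<delta>) x"
      unfolding MCauchy_iff[OF div]
    proof (intro conjI allI impI)
      fix e :: real assume "e > 0"
      then have e3: "e / 3 > 0"
        by simp
      obtain N1 where N1: "\<And>n m. n \<ge> N1 \<Longrightarrow> m \<ge> N1 \<Longrightarrow> dC' {\<sigma> n, \<sigma> m} < e / 3"
        using \<sigma> e3 unfolding MCauchy_iff[OF divC] by meson
      obtain N2 where N2: "\<And>n. n \<ge> N2 \<Longrightarrow> norm (dC' {\<sigma> n, const_class X \<delta> (x n)} - 0) < e / 3"
        using LIMSEQ_D[OF near e3] by blast
      have "\<delta> {x n, x m} < e" if "n \<ge> max N1 N2" "m \<ge> max N1 N2" for n m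
      proof -
        have "dC' {const_class X \<delta> (x n), const_class X \<delta> (x m)} \<le> dC' {const_class X \<delta> (x n), \<sigma> n} + dC' {\<sigma> n, const_class X \<delta> (x m)}"
          by (intro diversity_triangle[OF divC] iC \<sigma>C)
        also have "dC' {\<sigma> n, const_class X \<delta> (x m)} \<le> dC' {\<sigma> n, \<sigma> m} + dC' {\<sigma> m, const_class X \<delta> (x m)}"
          by (intro diversity_triangle[OF divC] iC \<sigma>C)
        finally show ?thesis
          using N1[of n m] N2[of n] N2[of m] that const_class_pair[OF div x(1) x(1), of n m]
          by (simp add: insert_commute)
      qed
      then show "\<exists>N. \<forall>n\<ge>N. \<forall>m\<ge>N. \<delta> {x n, x m} < e"
        by blast
    qed (use x in auto)
    note c = completion_class[OF div this]
    let ?c = "cauchy_rel X \<delta> `` {x}"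
    have "norm (induced_dist C' dC' (\<sigma> n) ?c) \<le> dC' {\<sigma> n, const_class X \<delta> (x n)} + dC' {?c, const_class X \<delta> (x n)}" for n
      using diversity_triangle[OF divC \<sigma>C[of n] iC[of n] c(1)] diversity_dist[OF divC \<sigma>C[of n] c(1)]
      by (simp add: insert_commute)
    then have "(\<lambda>n. induced_dist C' dC' (\<sigma> n) ?c) \<longlonglongrightarrow> 0"
      by (intro Lim_null_comparison[OF always_eventually tendsto_add_zero[OF near const_class_tendsto[OF div c]]] allI)
    then have "limitin C.mtopology \<sigma> ?c sequentially"
      using c(1) \<sigma>C unfolding C.limitin_metric_dist_null by simp
    then show ?thesis
      by blast
  qed
  then show ?thesis
    by (simp add: complete_diversity_def divC C.mcomplete_def)
qed

lemma polish_completion: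
  assumes "sep X \<delta>"
  shows "polish_diversity C' dC'"
  using complete_completion sep_completion[OF assms] separable_iff_sep[OF divC] divC
  by (simp add: polish_diversity_def separable_diversity_def)

end

section \<open>Universality\<close>

context
  fixes W :: "'p set" and \<rho> :: "'p set \<Rightarrow> real" and Y :: "'b set" and \<delta> :: "'b set \<Rightarrow> real"
  assumes W: "diversity W \<rho>" "W \<noteq> {}" and Y: "diversity Y \<delta>"
    and extension: "\<And>S f. S \<in> Fpow W \<Longrightarrow> S \<noteq> {} \<Longrightarrow> adm S \<rho> f \<Longrightarrow>
      \<exists>z\<in>W. \<forall>A\<in>Fpow S. \<rho> (insert z A) = f A"
begin

text \<open>The function that \<open>y n\<close> induces on the earlier \<open>y i\<close> is
  carried over to the \<open>z i\<close>, where it is admissible and hence realised by some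
  w.\<close>

lemma extend_embedding:
  fixes z :: "nat \<Rightarrow> 'p" and y :: "nat \<Rightarrow> 'b"
  assumes y: "range y \<subseteq> Y" and z: "\<forall>I\<subseteq>{..<n}. z ` I \<subseteq> W \<and> \<rho> (z ` I) = \<delta> (y ` I)"
  shows "\<exists>w\<in>W. \<forall>I\<subseteq>{..<n}. \<rho> (insert w (z ` I)) = \<delta> (insert (y n) (y ` I))"
\<comment> \<open>\<open>extension\<close> needs a nonempty set; at the start any point will
  do.\<close>
proof (cases "n = 0")
  case True
  obtain w where "w \<in> W"
    using W(2) by blast
  moreover have "\<delta> {y n} = 0"
    using y by (intro diversity_single[OF Y]) blast
  ultimately show ?thesis
    using True diversity_single[OF W(1), of w] by (intro bexI[of _ w]) simp_all
next
  case False
  let ?S = "z ` {..<n}"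
  have S: "?S \<in> Fpow W" "?S \<noteq> {}"
    using z False by (auto simp: Fpow_iff)
  \<comment> \<open>The sequences may repeat, so a set of points of z is pulled back to all of its
    indices.\<close>
  define J where "J A = {i. i < n \<and> z i \<in> A}" for A
  define f where "f A = \<delta> (insert (y n) (y ` J A))" for A
  have J_Un: "J (A \<union> B) = J A \<union> J B" for A B
    by (auto simp: J_def)
  have zJ: "z ` J A = A" if "A \<in> Fpow ?S" for A
    using that by (auto simp: J_def Fpow_iff)
  have "J A \<subseteq> {..<n}" for A
    by (auto simp: J_def)
  then have \<rho>: "\<rho> A = \<delta> (y ` J A)" if "A \<in> Fpow ?S" for A
    using z zJ[OF that] by metis
  have yJ: "y ` J A \<in> Fpow Y" "insert (y n) (y ` J A) \<in> Fpow Y" for A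
    using y by (auto simp: J_def Fpow_iff)
  have "adm ?S \<rho> f"
    unfolding adm_def lip_functional_def
  proof (intro conjI ballI impI)
    show "f {} = 0"
      using y diversity_single[OF Y, of "y n"] by (auto simp: f_def J_def)
    fix A assume A: "A \<in> Fpow ?S"
    show "\<rho> A \<le> f A"
      unfolding f_def \<rho>[OF A] by (rule diversity_mono[OF Y yJ(2)]) auto
    fix B assume B: "B \<in> Fpow ?S"
    show "f (A \<union> B) \<le> f A + f B"
      using diversity_join[OF Y yJ(2)[of A] yJ(2)[of B], of "y n"] by (simp add: f_def J_Un image_Un)
    fix C assume C: "C \<in> Fpow ?S" "C \<noteq> {}"
    then have "y ` J C \<noteq> {}"
      using zJ[OF C(1)] by auto
    then have "\<delta> (insert (y n) (y ` J A) \<union> y ` J B) \<le>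
        \<delta> (insert (y n) (y ` J A) \<union> y ` J C) + \<delta> (y ` J B \<union> y ` J C)"
      by (intro diversity_lip[OF Y, unfolded lip_functional_def, rule_format] yJ)
    then show "f (A \<union> B) \<le> f (A \<union> C) + \<rho> (B \<union> C)"
      using \<rho>[OF Fpow_Un[OF B C(1)]] by (simp add: f_def J_Un image_Un)
  qed
  then obtain w where w: "w \<in> W" "\<And>A. A \<in> Fpow ?S \<Longrightarrow> \<rho> (insert w A) = f A"
    using extension[OF S] by blast
  have "\<rho> (insert w (z ` I)) = \<delta> (insert (y n) (y ` I))" if I: "I \<subseteq> {..<n}" for I
  proof -
    \<comment> \<open>Equal entries of z have equal partners in y, as the distances agree; so
      pulling back to all indices adds no new points of y.\<close>
    have eq: "y i = y j" if "i < n" "j < n" "z i = z j" for i j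
    proof -
      have "\<delta> (y ` {i, j}) = \<rho> (z ` {i, j})"
        using z[rule_format, of "{i, j}"] that by simp
      also have "\<dots> = 0"
        using that z[rule_format, of "{j}"] diversity_single[OF W(1), of "z j"] by auto
      finally show ?thesis
        using diversity_pair[OF Y, of "y i" "y j"] y by (simp add: range_subsetD)
    qed
    have "y ` J (z ` I) = y ` I"
    proof
      show "y ` J (z ` I) \<subseteq> y ` I"
      proof
        fix b assume "b \<in> y ` J (z ` I)"
        then obtain i j where "i < n" "j \<in> I" "z i = z j" "b = y i"
          by (auto simp: J_def)
        then show "b \<in> y ` I"
          using eq[of i j] I by auto
      qed
      show "y ` I \<subseteq> y ` J (z ` I)"
        using I by (auto simp: J_def)
    qed
    moreover have "z ` I \<in> Fpow ?S"
      using I by (auto simp: Fpow_iff finite_subset)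
    ultimately show ?thesis
      using w(2) by (simp add: f_def)
  qed
  then show ?thesis
    using w(1) by blast
qed

lemma embed_sequence:
  fixes y :: "nat \<Rightarrow> 'b"
  assumes y: "range y \<subseteq> Y"
  shows "\<exists>z :: nat \<Rightarrow> 'p. range z \<subseteq> W \<and> (\<forall>I. finite I \<longrightarrow> \<rho> (z ` I) = \<delta> (y ` I))"
proof -
  \<comment> \<open>A partial embedding is a total sequence of which only the first n entries are
    constrained.\<close>
  define P where "P n z \<longleftrightarrow> (\<forall>I\<subseteq>{..<n}. z ` I \<subseteq> W \<and> \<rho> (z ` I) = \<delta> (y ` I))" for n and z :: "nat \<Rightarrow> 'p"
  define Q where "Q n z z' \<longleftrightarrow> (\<forall>i<n. z' i = z i)" for n and z z' :: "nat \<Rightarrow> 'p"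
  have "\<exists>F. \<forall>n. P n (F n) \<and> Q n (F n) (F (Suc n))"
  proof (rule dependent_nat_choice)
    show "\<exists>z. P 0 z"
      using diversity_empty[OF W(1)] diversity_empty[OF Y] by (simp add: P_def)
    fix z n assume z: "P n z"
    obtain w where w: "w \<in> W" "\<And>I. I \<subseteq> {..<n} \<Longrightarrow> \<rho> (insert w (z ` I)) = \<delta> (insert (y n) (y ` I))"
      using extend_embedding[OF y z[unfolded P_def]] by blast
    have "P (Suc n) (z(n := w))"
      unfolding P_def
    proof (intro allI impI)
      fix I assume I: "I \<subseteq> {..<Suc n}"
      let ?I = "I - {n}"
      have sub: "?I \<subseteq> {..<n}"
        using I by auto
      have old: "z(n := w) ` ?I = z ` ?I"
        by auto
      show "z(n := w) ` I \<subseteq> W \<and> \<rho> (z(n := w) ` I) = \<delta> (y ` I)"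
      proof (cases "n \<in> I")
        case True
        then have "I = insert n ?I"
          by auto
        then have "z(n := w) ` I = insert w (z ` ?I)" "y ` I = insert (y n) (y ` ?I)"
          using old by (metis fun_upd_same image_insert, metis image_insert)
        then show ?thesis
          using w(1) w(2)[OF sub] z sub by (simp add: P_def)
      next
        case False
        then have "?I = I"
          by auto
        then show ?thesis
          using old z sub by (simp add: P_def)
      qed
    qed
    moreover have "Q n z (z(n := w))"
      by (simp add: Q_def)
    ultimately show "\<exists>z'. P (Suc n) z' \<and> Q n z z'"
      by blast
  qed
  then obtain F where F: "\<And>n. P n (F n)" "\<And>n. Q n (F n) (F (Suc n))"
    by blast
  \<comment> \<open>Entry i is settled at stage \<open>Suc i\<close> and never changes
    afterwards.\<close>
  define z where "z i = F (Suc i) i" for i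
  have agree: "F m i = z i" if "i < m" for i m
    using that
  proof (induction m)
    case (Suc m)
    then show ?case
      using F(2)[of m] by (cases "i = m") (auto simp: z_def Q_def)
  qed simp
  have z: "z ` I \<subseteq> W \<and> \<rho> (z ` I) = \<delta> (y ` I)" if "finite I" for I
  proof -
    obtain m where m: "I \<subseteq> {..<m}"
      using \<open>finite I\<close> finite_nat_bounded by blast
    then have "F m ` I = z ` I"
      using agree by (intro image_cong) auto
    then show ?thesis
      using F(1)[of m] m by (metis P_def)
  qed
  have "range z \<subseteq> W"
    using z[of "{i}" for i] by auto
  then show ?thesis
    using z by (intro exI[of _ z]) simp
qed

text \<open>A point a is the limit of dense points; their copies in \<open>W\<close> have the same
  mutual distances, so they form a Cauchy sequence, whose class is the image of a. The equality of
  values on finite sets passes to the limit, and on pairs it gives injectivity.\<close>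

lemma embed_in_completion:
  assumes sep: "sep Y \<delta>"
  shows "\<exists>Z\<subseteq>completion_set W \<rho>. isomorphic_diversities Y \<delta> Z (completion_div \<rho>)"
\<comment> \<open>The empty space has no dense sequence to enumerate.\<close>
proof (cases "Y = {}")
  case True
  have divC: "diversity (completion_set W \<rho>) (completion_div \<rho>)"
    by (rule diversity_completion[OF W(1)])
  have "diversity_iso Y \<delta> {} (completion_div \<rho>) undefined"
    using True diversity_empty[OF Y] diversity_empty[OF divC]
    by (auto simp: diversity_iso_def Fpow_iff bij_betw_def)
  then show ?thesis
    unfolding isomorphic_diversities_def by blast
next
  case False
  obtain D where D: "countable D" "D \<subseteq> Y" "\<And>x e. x \<in> Y \<Longrightarrow> e > 0 \<Longrightarrow> \<exists>y\<in>D. \<delta> {x, y} < e"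
    using sep unfolding sep_def by blast
  obtain a where "a \<in> Y"
    using False by blast
  then have "D \<noteq> {}"
    using D(3)[of a 1] by auto
  then obtain y :: "nat \<Rightarrow> 'b" where y: "range y = D"
    using that[OF range_from_nat_into[OF _ D(1)]] by simp
  then have yY: "range y \<subseteq> Y"
    using D by blast
  obtain z :: "nat \<Rightarrow> 'p" where "range z \<subseteq> W \<and> (\<forall>I. finite I \<longrightarrow> \<rho> (z ` I) = \<delta> (y ` I))"
    using embed_sequence[OF yY] ..
  then have z: "range z \<subseteq> W" "\<And>I. finite I \<Longrightarrow> \<rho> (z ` I) = \<delta> (y ` I)"
    by simp_all
  have "\<exists>i. \<delta> {a, y i} < inverse (real (Suc n))" if "a \<in> Y" for a n
  proof -
    have "inverse (real (Suc n)) > 0"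
      by simp
    then obtain b where "b \<in> D" "\<delta> {a, b} < inverse (real (Suc n))"
      using D(3)[OF \<open>a \<in> Y\<close>] by meson
    then show ?thesis
      using y by blast
  qed
  then obtain k where k: "\<And>a n. a \<in> Y \<Longrightarrow> \<delta> {a, y (k a n)} < inverse (real (Suc n))"
    by metis
  have near: "(\<lambda>n. \<delta> {a, y (k a n)}) \<longlonglongrightarrow> 0" if a: "a \<in> Y" for a
  proof (rule Lim_null_comparison[OF always_eventually LIMSEQ_inverse_real_of_nat], intro allI)
    fix n
    show "norm (\<delta> {a, y (k a n)}) \<le> inverse (real (Suc n))"
      using k[OF a, of n] diversity_dist(2)[OF Y a, of "y (k a n)"] yY by (simp add: range_subsetD)
  qed
  define s where "s a n = z (k a n)" for a n
  have cauchy: "Metric_space.MCauchy W (induced_dist W \<rho>) (s a)" if a: "a \<in> Y" for a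
    unfolding MCauchy_iff[OF W(1)]
  proof (intro conjI allI impI)
    show "range (s a) \<subseteq> W"
      using z(1) by (auto simp: s_def)
    fix e :: real assume "e > 0"
    then have e2: "e / 2 > 0"
      by simp
    obtain N where N: "\<And>n. n \<ge> N \<Longrightarrow> norm (\<delta> {a, y (k a n)} - 0) < e / 2"
      using LIMSEQ_D[OF near[OF a] e2] by blast
    have "\<rho> {s a n, s a m} < e" if "n \<ge> N" "m \<ge> N" for n m
    proof -
      have "\<rho> {s a n, s a m} = \<delta> {y (k a n), y (k a m)}"
        using z(2)[of "{k a n, k a m}"] by (simp add: s_def)
      also have "\<dots> \<le> \<delta> {y (k a n), a} + \<delta> {a, y (k a m)}"
        using a yY by (intro diversity_triangle[OF Y]) auto
      also have "\<dots> < e"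
        using N[OF that(1)] N[OF that(2)] by (simp add: insert_commute)
      finally show ?thesis .
    qed
    then show "\<exists>N. \<forall>n\<ge>N. \<forall>m\<ge>N. \<rho> {s a n, s a m} < e"
      by blast
  qed
  define \<Phi> where "\<Phi> a = cauchy_rel W \<rho> `` {s a}" for a
  have \<Phi>: "\<Phi> a \<in> completion_set W \<rho>" "s a \<in> \<Phi> a" if "a \<in> Y" for a
    using completion_class[OF W(1) cauchy[OF that]] by (simp_all add: \<Phi>_def)
  have iso: "completion_div \<rho> (\<Phi> ` A) = \<delta> A" if A: "A \<in> Fpow Y" for A
  proof -
    have A': "finite A" "A \<subseteq> Y"
      using A by (auto simp: Fpow_iff)
    have "(\<lambda>n. \<rho> ((\<lambda>a. s a n) ` A)) \<longlonglongrightarrow> completion_div \<rho> (\<Phi> ` A)"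
      using A' \<Phi> by (intro completion_div_tendsto[OF W(1)]) auto
    moreover have "\<rho> ((\<lambda>a. s a n) ` A) = \<delta> ((\<lambda>a. y (k a n)) ` A)" for n
      using z(2)[of "(\<lambda>a. k a n) ` A"] A' by (simp add: s_def image_image)
    moreover have "(\<lambda>n. \<delta> ((\<lambda>a. y (k a n)) ` A)) \<longlonglongrightarrow> \<delta> A"
    proof (rule diversity_tendsto_cong[OF Y A'(1), of "\<lambda>a n. a"])
      show "\<And>i n. i \<in> A \<Longrightarrow> i \<in> Y" "\<And>i n. i \<in> A \<Longrightarrow> y (k i n) \<in> Y"
        using A' yY by auto
      show "(\<lambda>n. \<delta> {i, y (k i n)}) \<longlonglongrightarrow> 0" if "i \<in> A" for i
        using that A' by (intro near) auto
    qed simp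
    ultimately show ?thesis
      using LIMSEQ_unique by simp
  qed
  have "inj_on \<Phi> Y"
  proof (rule inj_onI)
    fix a b assume ab: "a \<in> Y" "b \<in> Y" "\<Phi> a = \<Phi> b"
    then have "\<delta> {a, b} = \<delta> {b}"
      using iso[of "{a, b}"] iso[of "{b}"] by (simp add: Fpow_iff)
    then show "a = b"
      using diversity_singleton_eq[OF Y ab(1,2)] by simp
  qed
  then have "diversity_iso Y \<delta> (\<Phi> ` Y) (completion_div \<rho>) \<Phi>"
    using iso by (simp add: diversity_iso_def inj_on_imp_bij_betw)
  moreover have "\<Phi> ` Y \<subseteq> completion_set W \<rho>"
    using \<Phi>(1) by auto
  ultimately show ?thesis
    unfolding isomorphic_diversities_def by blast
qed

end

theorem theorem20:
  shows "polish_diversity U_set U_div \<and>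
    (\<forall>(Y :: 'b set) \<delta>Y. separable_diversity Y \<delta>Y \<longrightarrow>
       (\<exists>Z \<subseteq> U_set. isomorphic_diversities Y \<delta>Y Z U_div))"
proof -
  let ?W = "omega_set {()} (\<lambda>_. 0)" and ?\<rho> = "omega_div {()} (\<lambda>_. 0)"
  have "card A \<le> 1" for A :: "unit set"
    using card_mono[of UNIV A] by simp
  then have point: "diversity {()} (\<lambda>_. 0)"
    by (simp add: diversity_def)
  have sep: "sep {()} (\<lambda>_. 0)"
    unfolding sep_def by (intro exI[of _ "{()}"]) auto
  have W: "diversity ?W ?\<rho>" "?W \<noteq> {}" "sep ?W ?\<rho>"
    using diversity_omega[OF point] omega_nonempty[OF point] sep_omega[OF point _ sep] by simp_all
  have "polish_diversity U_set U_div"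
    unfolding U_set_def U_div_def by (rule polish_completion[OF W(1,3)])
  moreover have "\<exists>Z\<subseteq>U_set. isomorphic_diversities Y \<delta>Y Z U_div"
    if "separable_diversity Y \<delta>Y" for Y :: "'b set" and \<delta>Y
    unfolding U_set_def U_div_def
  proof (rule embed_in_completion[OF W(1,2)])
    show Y: "diversity Y \<delta>Y"
      using that by (simp add: separable_diversity_def)
    show "sep Y \<delta>Y"
      using that separable_iff_sep[OF Y] by (simp add: separable_diversity_def)
    show "\<exists>z\<in>?W. \<forall>A\<in>Fpow S. ?\<rho> (insert z A) = f A"
      if "S \<in> Fpow ?W" "S \<noteq> {}" "adm S ?\<rho> f" for S f
      by (rule omega_extension[OF point _ that]) simp
  qed
  ultimately show ?thesis
    by blast
qed

end
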